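(* Let $p,n$ be positive integers with $p\ge n\ge 11$, let $r\in\{2,3,\ldots,n-6\}$ and suppose $p\equiv r\pmod{n-1}$. Let $m\in\{0,1,\ldots,r+1\}$ be given by $n-3\equiv m\pmod{r+2}$. Then $$ex(p;T_n^* )=\begin{cases}\left\lfloor\frac{(n-2)(p-1)-2r-m-3}{2}\right\rfloor & \text{if } r\ge 4 \text{ and } 2\le m\le r-1,\\[4pt] \frac{(n-2)(p-1)-m(r+2-m)-r-1}{2} & \text{otherwise.}\end{cases}$$
   Context: All graphs are finite simple graphs. For $n\ge 4$, $T_n^*$ denotes the tree on the $n$ vertices $v_0,v_1,\ldots,v_{n-1}$ with edge set $\{v_0v_1,\ldots,v_0v_{n-3},\,v_{n-3}v_{n-2},\,v_{n-2}v_{n-1}\}$. For a graph $L$, $ex(p;L)$ denotes the maximal number of edges in a graph on $p$ vertices that does not contain $L$ as a (not necessarily induced) subgraph. *)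

theory Defs
  imports Complex_Main "HOL-Library.Ramsey" "HOL-Number_Theory.Cong"
begin

text \<open>A graph is a pair of a vertex set and an edge set; edges are two-element sets of vertices.\<close>

type_synonym 'a graph = "'a set \<times> 'a set set"

abbreviation verts :: "'a graph \<Rightarrow> 'a set" where
  "verts G \<equiv> fst G"

abbreviation edges :: "'a graph \<Rightarrow> 'a set set" where
  "edges G \<equiv> snd G"

definition finite_simple_graph :: "'a graph \<Rightarrow> bool" where
  "finite_simple_graph G \<longleftrightarrow> finite (verts G) \<and> edges G \<subseteq> [verts G]\<^bsup>2\<^esup>"

text \<open>\<open>G\<close> contains a (not necessarily induced) subgraph isomorphic to \<open>L\<close>.\<close>

definition contains_subgraph :: "'a graph \<Rightarrow> 'b graph \<Rightarrow> bool" where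
  "contains_subgraph G L \<longleftrightarrow>
     (\<exists>f. inj_on f (verts L) \<and> f ` verts L \<subseteq> verts G \<and> (\<forall>e \<in> edges L. f ` e \<in> edges G))"

text \<open>Every finite graph is isomorphic to one whose vertices are natural numbers, so
  restricting the vertex type to \<^typ>\<open>nat\<close> loses nothing. The set below is finite, since
  a graph on \<open>p\<close> vertices has at most \<open>p choose 2\<close> edges, and it is nonempty
  whenever \<open>L\<close> has at least one edge.\<close>

definition turan_number :: "nat \<Rightarrow> 'b graph \<Rightarrow> nat" where
  "turan_number p L =
     Max {card (edges G) | G :: nat graph.
            finite_simple_graph G \<and> card (verts G) = p \<and> \<not> contains_subgraph G L}"

text \<open>The vertex \<open>i\<close> stands for \<open>v\<^sub>i\<close>; the definition is meaningful for \<open>n \<ge> 4\<close>.\<close>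

definition T_star :: "nat \<Rightarrow> nat graph" where
  "T_star n = ({0..n - 1}, {{0, i} | i. i \<in> {1..n - 3}} \<union> {{n - 3, n - 2}, {n - 2, n - 1}})"

end

theory Submission
  imports Defs "HOL-Library.Disjoint_Sets"
begin

text \<open>Measure a graph on \<open>p\<close> vertices by its deficiency, the degree sum missing to
  \<open>(n - 2)\<close>-regularity. It is additive over connected components and vanishes for copies of
  \<open>K\<^sub>n\<^sub>-\<^sub>1\<close>. A \<open>T\<^sub>n\<^sup>*\<close>-free component \<open>C\<close> with at least \<open>n\<close> vertices
  has deficiency at least \<open>card C\<close>, so that the optimum consists of copies of \<open>K\<^sub>n\<^sub>-\<^sub>1\<close> and
  one component \<open>C\<close> with \<open>n - 1 + r\<close> vertices. There one may assume that all degrees are at most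
  \<open>n - 3\<close>, and a vertex of degree \<open>n - 3\<close> has only independent non-neighbours, \<open>s = r + 2\<close> of
  them when the vertex itself is included. With \<open>n - 3 \<equiv> m (mod s)\<close>, the degree sum of such a
  component stays below \<open>(n - 3) card C\<close> by at least \<open>min (m (s - m)) (s + m)\<close>.

  Up to parity this is attained by joining independent sets of size \<open>s\<close> to a suitable graph on
  \<open>s + m\<close> vertices: either \<open>K\<^sub>m\<^sub>,\<^sub>m\<close> with isolated vertices or an (almost)
  \<open>(m - 1)\<close>-regular graph.\<close>

section \<open>Neighbourhoods, embeddings and the loss bound\<close>

definition nbrs :: "'a set set \<Rightarrow> 'a \<Rightarrow> 'a set" where
  "nbrs E v = {u. {u, v} \<in> E}"

lemma nbrs_sym: "u \<in> nbrs E v \<longleftrightarrow> v \<in> nbrs E u"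
  by (simp add: nbrs_def insert_commute)

lemma nbrs_subset: "E \<subseteq> [V]\<^bsup>2\<^esup> \<Longrightarrow> nbrs E v \<subseteq> V"
  by (auto simp: nbrs_def nsets_def)

lemma nbrs_irrefl: "E \<subseteq> [V]\<^bsup>2\<^esup> \<Longrightarrow> v \<notin> nbrs E v"
  by (auto simp: nbrs_def nsets_def)

lemma finite_edges: "finite V \<Longrightarrow> E \<subseteq> [V]\<^bsup>2\<^esup> \<Longrightarrow> finite E"
  by (meson finite_imp_finite_nsets finite_subset)

lemma card_nbrs_eq_incident:
  assumes "E \<subseteq> [V]\<^bsup>2\<^esup>"
  shows "card (nbrs E v) = card {e \<in> E. v \<in> e}"
proof (rule bij_betw_same_card[of "\<lambda>u. {u, v}"])
  have "e \<in> (\<lambda>u. {u, v}) ` nbrs E v" if "e \<in> E" "v \<in> e" for e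
  proof -
    from that assms have "card e = 2" by (auto simp: nsets_def)
    then obtain a b where "e = {a, b}" by (meson card_2_iff)
    with that show ?thesis by (auto simp: nbrs_def insert_commute)
  qed
  then show "bij_betw (\<lambda>u. {u, v}) (nbrs E v) {e \<in> E. v \<in> e}"
    by (auto simp: bij_betw_def inj_on_def doubleton_eq_iff nbrs_def)
qed

lemma handshake:
  assumes "finite V" "E \<subseteq> [V]\<^bsup>2\<^esup>"
  shows "(\<Sum>v\<in>V. card (nbrs E v)) = 2 * card E"
proof -
  have "card {v \<in> V. v \<in> e} = 2" if "e \<in> E" for e
  proof -
    have "{v \<in> V. v \<in> e} = e" "card e = 2" using that assms(2) by (auto simp: nsets_def)
    then show ?thesis by simp
  qed
  then have "(\<Sum>v\<in>V. card {e \<in> E. v \<in> e}) = 2 * card E"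
    by (intro sum_multicount) (use assms finite_edges in auto)
  then show ?thesis by (simp add: card_nbrs_eq_incident[OF assms(2)])
qed

lemma verts_T_star: "verts (T_star n) = {0..n - 1}"
  by (simp add: T_star_def)

text \<open>The tree is a path \<open>c, b, x, y\<close> with \<open>n - 4\<close> leaves added at
  \<open>c\<close>. Since \<open>x\<close> and \<open>y\<close> may be neighbours of
  \<open>c\<close> too, the leaves are chosen outside \<open>{b, x, y}\<close>.\<close>

lemma T_star_subgraphI:
  fixes V :: "'a set"
  assumes fin: "finite V" and E: "E \<subseteq> [V]\<^bsup>2\<^esup>" and n: "5 \<le> n"
    and b: "b \<in> nbrs E c" and x: "x \<in> nbrs E b" and y: "y \<in> nbrs E x"
    and neq: "x \<noteq> c" "y \<noteq> c" "y \<noteq> b"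
    and card: "n - 4 \<le> card (nbrs E c - {b, x, y})"
  shows "contains_subgraph (V, E) (T_star n)"
proof -
  have finN: "finite (nbrs E c)" using nbrs_subset[OF E] fin finite_subset by blast
  have neq': "b \<noteq> c" "x \<noteq> b" "y \<noteq> x" using b x y nbrs_irrefl[OF E] by blast+
  have mem: "c \<in> V" "b \<in> V" "x \<in> V" "y \<in> V" "nbrs E c \<subseteq> V"
    using b x y nbrs_subset[OF E] nbrs_sym[of b E c] by blast+
  obtain g where g: "g ` {1..n - 4} \<subseteq> nbrs E c - {b, x, y}" "inj_on g {1..n - 4}"
    using card_le_inj[of "{1..n - 4}" "nbrs E c - {b, x, y}"] card finN by auto
  define f where "f i = (if i = 0 then c else if i = n - 3 then b else if i = n - 2 then x
      else if i = n - 1 then y else g i)" for i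
  have f: "f 0 = c" "f (n - 3) = b" "f (n - 2) = x" "f (n - 1) = y"
    using n by (auto simp: f_def)
  have fg: "f i = g i" if "i \<in> {1..n - 4}" for i using that n by (auto simp: f_def)
  have split: "{0..n - 1} = {1..n - 4} \<union> {0, n - 3, n - 2, n - 1}" using n by auto
  have gN: "g i \<in> nbrs E c" "g i \<notin> {b, x, y}" "g i \<noteq> c" if "i \<in> {1..n - 4}" for i
    using g(1) that nbrs_irrefl[OF E] by blast+
  have "inj_on f ({1..n - 4} \<union> {0, n - 3, n - 2, n - 1})"
  proof (subst inj_on_Un, intro conjI)
    show "inj_on f {1..n - 4}" using g(2) fg inj_on_cong[of "{1..n - 4}" f g] by blast
    show "inj_on f {0, n - 3, n - 2, n - 1}"
      unfolding inj_on_def using f neq neq' by (metis insertE singletonD)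
    have "f i \<notin> {b, x, y, c}" if "i \<in> {1..n - 4}" for i using fg[OF that] gN[OF that] by simp
    then have "f ` {1..n - 4} \<inter> {b, x, y, c} = {}" by blast
    moreover have "f ` {0, n - 3, n - 2, n - 1} = {b, x, y, c}" unfolding image_insert f by blast
    ultimately show "f ` ({1..n - 4} - {0, n - 3, n - 2, n - 1}) \<inter> f ` ({0, n - 3, n - 2, n - 1} - {1..n - 4}) = {}"
      by blast
  qed
  moreover have "f ` {0..n - 1} \<subseteq> V" unfolding split image_Un image_insert f using fg gN(1) mem by auto
  moreover have "f ` e \<in> E" if "e \<in> edges (T_star n)" for e
  proof -
    have "e \<in> {{0, i} | i. i \<in> {1..n - 3}} \<or> e = {n - 3, n - 2} \<or> e = {n - 2, n - 1}"
      using that by (auto simp: T_star_def)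
    moreover have "{c, f i} \<in> E" if "i \<in> {1..n - 3}" for i
    proof (cases "i = n - 3")
      case True then show ?thesis using b f by (simp add: nbrs_def insert_commute)
    next
      case False
      then have "i \<in> {1..n - 4}" using that by auto
      then show ?thesis using fg gN by (auto simp: nbrs_def insert_commute)
    qed
    ultimately show ?thesis using f x y by (auto simp: nbrs_def insert_commute)
  qed
  ultimately show ?thesis
    unfolding contains_subgraph_def verts_T_star split by auto
qed

text \<open>The loss of a graph of maximum degree \<open>d\<close> is the degree sum missing to \<open>d\<close>-regularity;
  here \<open>M v\<close> is the set of non-neighbours of \<open>v\<close>, including \<open>v\<close>, so \<open>s = card V - d\<close>.
  The proof takes a maximal disjoint family of the cliques \<open>M v\<close> with \<open>card (M v) = s\<close> and counts
  the pairs between their union \<open>B\<close> and the remaining vertices \<open>R\<close>. Maximality ensures that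
  a vertex of \<open>R\<close> without loss has a non-neighbour in \<open>B\<close>.\<close>

lemma loss_lower_bound:
  fixes V :: "'a set" and M :: "'a \<Rightarrow> 'a set"
  assumes fin: "finite V" and s: "0 < s"
    and refl: "\<And>v. v \<in> V \<Longrightarrow> v \<in> M v" and sub: "\<And>v. v \<in> V \<Longrightarrow> M v \<subseteq> V"
    and sym: "\<And>u v. u \<in> V \<Longrightarrow> v \<in> V \<Longrightarrow> u \<in> M v \<longleftrightarrow> v \<in> M u"
    and ge: "\<And>v. v \<in> V \<Longrightarrow> s \<le> card (M v)"
    and clique: "\<And>v x y. v \<in> V \<Longrightarrow> card (M v) = s \<Longrightarrow> x \<in> M v \<Longrightarrow> y \<in> M v \<Longrightarrow> y \<in> M x"
  defines "m \<equiv> card V mod s"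
  shows "min (m * (s - m)) (s + m) \<le> (\<Sum>v\<in>V. card (M v) - s)"
proof -
  define \<A> where "\<A> = M ` {v \<in> V. card (M v) = s}"
  define \<P> where "\<P> = {F. F \<subseteq> \<A> \<and> disjoint F}"
  have fA: "finite \<A>" using fin by (simp add: \<A>_def)
  then have "finite \<P>" by (auto simp: \<P>_def)
  moreover have "{} \<in> \<P>" by (simp add: \<P>_def disjoint_def)
  ultimately obtain F where F: "F \<in> \<P>" and max: "\<And>F'. F' \<in> \<P> \<Longrightarrow> F \<subseteq> F' \<Longrightarrow> F = F'"
    using finite_has_maximal[of \<P>] by blast
  have FA: "F \<subseteq> \<A>" and disj: "disjoint F" using F by (auto simp: \<P>_def)
  define B where "B = \<Union>F"
  define R where "R = V - B"
  have BV: "B \<subseteq> V" using FA sub by (fastforce simp: B_def \<A>_def)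
  have finM: "finite (M v)" if "v \<in> V" for v using sub[OF that] fin finite_subset by blast
  have fB: "finite B" and fR: "finite R" using BV fin finite_subset by (auto simp: R_def)
  have VBR: "V = B \<union> R" "B \<inter> R = {}" using BV by (auto simp: R_def)
  have "card B = (\<Sum>A\<in>F. card A)" unfolding B_def
    by (rule card_Union_disjoint) (use disj FA finM in \<open>auto simp: \<A>_def\<close>)
  also have "\<dots> = s * card F" using FA by (subst sum.cong[of F F _ "\<lambda>_. s"]) (auto simp: \<A>_def)
  finally have cB: "card B = s * card F" .
  have cV: "card V = card B + card R" using VBR fB fR card_Un_disjoint by metis
  have Rm: "card R mod s = m" unfolding m_def cV cB by simp
  \<comment> \<open>\<open>M v\<close> fills \<open>s\<close> elements of \<open>M x\<close> and
    misses \<open>R\<close>, so every non-neighbour of \<open>x\<close> in \<open>R\<close> counts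
    as excess.\<close>
  have lossB: "card (M x \<inter> R) \<le> card (M x) - s" if x: "x \<in> B" for x
  proof -
    obtain v where v: "v \<in> V" "card (M v) = s" "x \<in> M v" "M v \<in> F"
      using x FA by (auto simp: B_def \<A>_def)
    have "M v \<subseteq> M x" using clique v by blast
    moreover have "M v \<inter> R = {}" using v by (auto simp: R_def B_def)
    ultimately have "card (M v) + card (M x \<inter> R) \<le> card (M x)"
      using x BV finM v(1)
      by (subst card_Un_disjoint[symmetric]) (auto intro!: card_mono)
    then show ?thesis using v by simp
  qed
  have swap: "(\<Sum>x\<in>B. card (M x \<inter> R)) = (\<Sum>y\<in>R. card (M y \<inter> B))"
  proof -
    have 1: "M x \<inter> R = {y \<in> R. y \<in> M x}" for x by auto
    have 2: "M y \<inter> B = {x \<in> B. y \<in> M x}" if "y \<in> R" for y using sym that VBR by auto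
    have "(\<Sum>x\<in>B. card {y \<in> R. y \<in> M x}) = (\<Sum>y\<in>R. card {x \<in> B. y \<in> M x})"
      by (rule sum_multicount_gen) (use fB fR in auto)
    then show ?thesis using 1 2 by (simp cong: sum.cong)
  qed
  have tot: "(\<Sum>v\<in>V. card (M v) - s) = (\<Sum>v\<in>B. card (M v) - s) + (\<Sum>v\<in>R. card (M v) - s)"
    using VBR fB fR by (metis sum.union_disjoint)
  have "(\<Sum>x\<in>B. card (M x \<inter> R)) \<le> (\<Sum>x\<in>B. card (M x) - s)" by (intro sum_mono lossB)
  then have low: "(\<Sum>y\<in>R. card (M y \<inter> B) + (card (M y) - s)) \<le> (\<Sum>v\<in>V. card (M v) - s)"
    using tot swap by (simp add: sum.distrib)
  show ?thesis
  proof (cases "card R < s")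
    case True
    then have cR: "card R = m" using Rm by simp
    \<comment> \<open>At most \<open>m\<close> elements of \<open>M y\<close> fit into
      \<open>R\<close>, so at least \<open>s - m\<close> lie in \<open>B\<close>; the
      \<open>m\<close> vertices of \<open>R\<close> together pay \<open>m * (s - m)\<close>.\<close>
    have "s - m \<le> card (M y \<inter> B) + (card (M y) - s)" if y: "y \<in> R" for y
    proof -
      have yV: "y \<in> V" using y VBR by auto
      have "M y = (M y \<inter> B) \<union> (M y \<inter> R)" using sub[OF yV] VBR by auto
      then have "card (M y) \<le> card (M y \<inter> B) + card (M y \<inter> R)" by (metis card_Un_le)
      moreover have "card (M y \<inter> R) \<le> m" using cR fR by (metis Int_lower2 card_mono)
      ultimately show ?thesis using ge[OF yV] by simp
    qed
    then have "(\<Sum>y\<in>R. s - m) \<le> (\<Sum>y\<in>R. card (M y \<inter> B) + (card (M y) - s))"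
      by (intro sum_mono)
    then show ?thesis using low cR by simp
  next
    case False
    \<comment> \<open>\<open>card R\<close> is at least \<open>s\<close> and congruent to
      \<open>m\<close> modulo \<open>s\<close>; one unit per vertex of \<open>R\<close> now
      suffices.\<close>
    then have "s + m \<le> card R" using Rm s
      by (metis add.commute add_le_mono1 div_greater_zero_iff linorder_not_less mod_mult_div_eq
          mult.right_neutral mult_le_mono2 Suc_leI One_nat_def)
    have "1 \<le> card (M y \<inter> B) + (card (M y) - s)" if y: "y \<in> R" for y
    proof (rule ccontr)
      assume "\<not> ?thesis"
      moreover have yV: "y \<in> V" using y VBR by auto
      ultimately have "card (M y) = s" "card (M y \<inter> B) = 0" using ge[OF yV] by linarith+
      then have c: "card (M y) = s" "M y \<inter> B = {}" using fB by simp_all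
      have "insert (M y) F \<in> \<P>"
        using c FA disj yV by (auto simp: \<P>_def disjoint_def \<A>_def B_def)
      then have "M y \<in> F" using max by blast
      then show False using refl[OF yV] y by (auto simp: R_def B_def)
    qed
    then have "(\<Sum>y\<in>R. 1) \<le> (\<Sum>y\<in>R. card (M y \<inter> B) + (card (M y) - s))"
      by (intro sum_mono)
    then show ?thesis using low \<open>s + m \<le> card R\<close> by simp
  qed
qed

section \<open>Deficiency of a connected component\<close>

text \<open>\<open>no_tree\<close> is what the absence of \<open>T\<^sub>n\<^sup>*\<close> means for the neighbourhoods: the path
  \<open>c, b, x, y\<close> can never be completed by \<open>n - 4\<close> further neighbours of \<open>c\<close>.\<close>

locale tree_free =
  fixes V :: "'a set" and N :: "'a \<Rightarrow> 'a set" and n :: nat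
  assumes fin: "finite V" and N_sub: "N v \<subseteq> V"
    and N_sym: "u \<in> N v \<Longrightarrow> v \<in> N u" and N_irrefl: "v \<notin> N v"
    and n: "11 \<le> n"
    and no_tree: "b \<in> N c \<Longrightarrow> x \<in> N b \<Longrightarrow> y \<in> N x \<Longrightarrow> x \<noteq> c \<Longrightarrow> y \<noteq> c \<Longrightarrow> y \<noteq> b
      \<Longrightarrow> card (N c - {b, x, y}) < n - 4"
begin

section \<open>Closed sets, components and deficiency\<close>

text \<open>These are exactly the unions of connected components.\<close>

definition closed_set :: "'a set \<Rightarrow> bool" where
  "closed_set C \<longleftrightarrow> C \<subseteq> V \<and> (\<forall>v\<in>C. N v \<subseteq> C)"

text \<open>Path-free form of connectedness: any nonempty closed subset of \<open>C\<close> exhausts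
  \<open>C\<close>.\<close>

definition component :: "'a set \<Rightarrow> bool" where
  "component C \<longleftrightarrow> closed_set C \<and> C \<noteq> {} \<and>
     (\<forall>D. closed_set D \<longrightarrow> D \<noteq> {} \<longrightarrow> D \<subseteq> C \<longrightarrow> D = C)"

text \<open>Integer-valued, since vertices of degree above \<open>n - 2\<close> contribute
  negatively.\<close>

definition deficiency :: "'a set \<Rightarrow> int" where
  "deficiency C = (\<Sum>v\<in>C. int n - 2 - int (card (N v)))"

lemma finite_N [simp]: "finite (N v)"
  using N_sub fin finite_subset by blast

lemma closed_set_finite: "closed_set C \<Longrightarrow> finite C"
  using fin finite_subset by (auto simp: closed_set_def)

lemma closed_set_Diff:
  assumes "closed_set C" "closed_set D"
  shows "closed_set (C - D)"
  using assms N_sym unfolding closed_set_def by blast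

lemma deficiency_Diff:
  assumes "closed_set C" "closed_set D" "D \<subseteq> C"
  shows "deficiency C = deficiency D + deficiency (C - D)"
  unfolding deficiency_def using assms closed_set_finite
  by (metis add.commute sum.subset_diff)

lemma card_Diff_closed_set:
  assumes "closed_set C" "D \<subseteq> C"
  shows "card C = card D + card (C - D)"
  using assms closed_set_finite
  by (metis card_Diff_subset card_mono finite_subset le_add_diff_inverse)

lemma ex_component:
  assumes "closed_set C" "C \<noteq> {}"
  obtains K where "component K" "K \<subseteq> C"
proof -
  define \<K> where "\<K> = {D. closed_set D \<and> D \<noteq> {} \<and> D \<subseteq> C}"
  have "finite \<K>" using closed_set_finite[OF assms(1)] by (auto simp: \<K>_def)
  moreover have "C \<in> \<K>" using assms by (simp add: \<K>_def)
  ultimately obtain K where "K \<in> \<K>" "\<And>D. D \<in> \<K> \<Longrightarrow> D \<subseteq> K \<Longrightarrow> K = D"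
    using finite_has_minimal[of \<K>] by blast
  then show thesis
    by (intro that[of K]) (auto simp: component_def \<K>_def)
qed

lemma deficiency_small:
  assumes "closed_set C" "card C \<le> n - 1"
  shows "int (card C * (n - 1 - card C)) \<le> deficiency C"
proof -
  have "int (n - 1 - card C) \<le> int n - 2 - int (card (N v))" if "v \<in> C" for v
  proof -
    have "N v \<subseteq> C - {v}" using that assms(1) N_irrefl by (auto simp: closed_set_def)
    then have "card (N v) \<le> card C - 1"
      using card_mono[of "C - {v}" "N v"] closed_set_finite[OF assms(1)] that by simp
    moreover have "1 \<le> card C"
      using that closed_set_finite[OF assms(1)] by (metis card_0_eq empty_iff less_one not_less)
    ultimately show ?thesis using assms(2) n by linarith
  qed
  then have "(\<Sum>v\<in>C. int (n - 1 - card C)) \<le> deficiency C"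
    unfolding deficiency_def by (intro sum_mono)
  then show ?thesis by simp
qed

section \<open>Components with a vertex of degree at least \<open>n - 3\<close>\<close>

text \<open>A path \<open>v, b, u, y\<close> with \<open>u\<close> and \<open>y\<close> outside
  \<open>N v\<close> leaves enough neighbours of \<open>v\<close> to complete the tree; if
  \<open>v\<close> has degree at least \<open>n - 2\<close>, so does a path returning to
  \<open>N v\<close> at some \<open>y\<close> other than \<open>b\<close>. Hence nothing lies beyond
  distance two from \<open>v\<close>.\<close>

lemma second_neighbours:
  assumes C: "component C" and v: "v \<in> C" and deg: "n - 3 \<le> card (N v)"
    and u: "u \<in> C" "u \<noteq> v" "u \<notin> N v"
  obtains b where "b \<in> N v" "u \<in> N b"
    "\<And>y. y \<in> N u \<Longrightarrow> y \<in> N v \<and> (n - 2 \<le> card (N v) \<longrightarrow> y = b)"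
proof -
  \<comment> \<open>The ball of radius two around \<open>v\<close>; it turns out to be closed and
    therefore equals \<open>C\<close>.\<close>
  define S where "S = insert v (N v \<union> (\<Union>b\<in>N v. N b))"
  have outer: "y \<in> N v \<and> (n - 2 \<le> card (N v) \<longrightarrow> y = b)"
    if b: "b \<in> N v" and x: "x \<in> N b" "x \<noteq> v" "x \<notin> N v" and y: "y \<in> N x" for b x y
  proof (rule ccontr)
    assume neg: "\<not> ?thesis"
    have yv: "y \<noteq> v" using x y N_sym by blast
    have yb: "y \<noteq> b" using neg b by blast
    have lt: "card (N v - {b, x, y}) < n - 4" using no_tree[OF b x(1) y x(2) yv yb] .
    show False
    proof (cases "y \<in> N v")
      case True
      then have "n - 2 \<le> card (N v)" using neg by blast
      moreover have "N v - {b, x, y} = N v - {b, y}" using x by blast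
      moreover have "card (N v - {b, y}) = card (N v) - 2"
        using True b yb by (subst card_Diff_subset) auto
      ultimately show False using lt by simp
    next
      case False
      then have "N v - {b, x, y} = N v - {b}" using x by blast
      then show False using lt deg b by simp
    qed
  qed
  have "closed_set S"
    unfolding closed_set_def
  proof (intro conjI ballI)
    show "S \<subseteq> V" using v C N_sub by (auto simp: S_def component_def closed_set_def)
    fix x assume x: "x \<in> S"
    show "N x \<subseteq> S"
    proof (cases "x = v \<or> x \<in> N v")
      case True then show ?thesis by (auto simp: S_def)
    next
      case False
      then obtain b where b: "b \<in> N v" "x \<in> N b" using x by (auto simp: S_def)
      have "x \<noteq> v" "x \<notin> N v" using False by auto
      from outer[OF b this] have "N x \<subseteq> N v" by blast
      then show ?thesis by (auto simp: S_def)
    qed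
  qed
  moreover have "S \<subseteq> C"
  proof -
    have NC: "\<forall>w\<in>C. N w \<subseteq> C" using C by (simp add: component_def closed_set_def)
    then have "N b \<subseteq> C" if "b \<in> N v" for b using v that by (meson subsetD)
    then show ?thesis unfolding S_def using v NC by (simp add: UN_least)
  qed
  moreover have "S \<noteq> {}" by (simp add: S_def)
  ultimately have "S = C" using C unfolding component_def by blast
  then have "u \<in> S" using u by simp
  then obtain b where b: "b \<in> N v" "u \<in> N b" using u(2,3) unfolding S_def by blast
  show thesis
  proof (rule that)
    show "b \<in> N v" "u \<in> N b" by fact+
    show "y \<in> N v \<and> (n - 2 \<le> card (N v) \<longrightarrow> y = b)" if "y \<in> N u" for y
      using outer[OF b u(2,3) that] .
  qed
qed

text \<open>Supplies the clique hypothesis of \<open>loss_lower_bound\<close>: by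
  \<open>second_neighbours\<close>, a vertex outside \<open>N v\<close> has all its neighbours in
  \<open>N v\<close>.\<close>

lemma nonneighbours_independent:
  assumes C: "component C" and v: "v \<in> C" and deg: "n - 3 \<le> card (N v)"
    and x: "x \<in> C - N v" and y: "y \<in> C - N v"
  shows "y \<notin> N x"
proof
  assume yx: "y \<in> N x"
  then have "x \<noteq> v" using y by blast
  then show False using second_neighbours[OF C v deg, of x] x y yx by blast
qed

text \<open>All vertices outside \<open>insert v B\<close> are pendant at \<open>B = N v\<close>, so
  the edges inside \<open>B\<close> govern the degree sum. They form a matching if \<open>v\<close>
  has degree at least \<open>n - 1\<close>; for degree \<open>n - 2\<close>, some vertex of
  \<open>B\<close> is isolated within \<open>B\<close>.\<close>

lemma deficiency_large_degree:
  assumes C: "component C" and big: "n \<le> card C" and v: "v \<in> C" and deg: "n - 2 \<le> card (N v)"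
  shows "int (card C) + int n - 3 \<le> deficiency C"
proof -
  define B where "B = N v"
  define O' where "O' = C - insert v B"
  define d where "d = card B"
  define q where "q = card O'"
  have cl: "closed_set C" using C by (simp add: component_def)
  have NC: "\<And>u. u \<in> C \<Longrightarrow> N u \<subseteq> C" using cl by (auto simp: closed_set_def)
  have fC: "finite C" using closed_set_finite cl by blast
  have fB: "finite B" and fO: "finite O'" using fC by (auto simp: B_def O'_def)
  have vB: "v \<notin> B" using N_irrefl by (simp add: B_def)
  have Csplit: "C = insert v (B \<union> O')" using v NC by (auto simp: O'_def B_def)
  have disj: "B \<inter> O' = {}" "v \<notin> O'" by (auto simp: O'_def)
  have cC: "card C = 1 + d + q"
    unfolding Csplit d_def q_def using fB fO vB disj by (simp add: card_Un_disjoint)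
  have deg3: "n - 3 \<le> card (N v)" using deg by simp
  have outer: "\<exists>b\<in>B. N x = {b}" if "x \<in> O'" for x
  proof -
    have "x \<in> C" "x \<noteq> v" "x \<notin> N v" using that by (auto simp: O'_def B_def)
    from second_neighbours[OF C v deg3 this] obtain b
      where "b \<in> N v" "x \<in> N b" "\<And>y. y \<in> N x \<Longrightarrow> y = b" using deg by metis
    then show ?thesis using N_sym by (auto simp: B_def)
  qed
  have sumO: "(\<Sum>x\<in>O'. card (N x)) = q"
  proof -
    have "card (N x) = 1" if "x \<in> O'" for x using outer[OF that] by auto
    then show ?thesis by (simp add: q_def)
  qed
  have swap: "(\<Sum>b\<in>B. card (N b \<inter> O')) \<le> q"
  proof -
    have 1: "N b \<inter> O' = {x \<in> O'. x \<in> N b}" for b by auto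
    have "(\<Sum>b\<in>B. card {x \<in> O'. x \<in> N b}) = (\<Sum>x\<in>O'. card {b \<in> B. x \<in> N b})"
      by (rule sum_multicount_gen) (use fB fO in auto)
    also have "\<dots> \<le> (\<Sum>x\<in>O'. card (N x))"
      by (intro sum_mono card_mono) (use N_sym in auto)
    finally show ?thesis unfolding 1 sumO .
  qed
  have degB: "card (N b) \<le> 1 + card (N b \<inter> B) + card (N b \<inter> O')" if "b \<in> B" for b
  proof -
    have "b \<in> C" using that Csplit by blast
    then have "N b \<subseteq> C" using NC by blast
    then have "N b \<subseteq> insert v ((N b \<inter> B) \<union> (N b \<inter> O'))" using Csplit by blast
    then have "card (N b) \<le> card (insert v ((N b \<inter> B) \<union> (N b \<inter> O')))" by (intro card_mono) auto
    also have "\<dots> \<le> 1 + card ((N b \<inter> B) \<union> (N b \<inter> O'))" by (metis card_insert_le_m1 diff_add_inverse le_refl plus_1_eq_Suc zero_less_Suc)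
    finally show ?thesis using card_Un_le[of "N b \<inter> B" "N b \<inter> O'"] by linarith
  qed
  define E where "E = (\<Sum>b\<in>B. card (N b \<inter> B))"
  have "(\<Sum>b\<in>B. card (N b)) \<le> (\<Sum>b\<in>B. 1 + card (N b \<inter> B) + card (N b \<inter> O'))"
    by (intro sum_mono degB)
  then have sumB: "(\<Sum>b\<in>B. card (N b)) \<le> d + E + q"
    using swap by (simp add: sum.distrib sum_Suc E_def d_def)
  have "(\<Sum>u\<in>C. card (N u)) = d + ((\<Sum>b\<in>B. card (N b)) + (\<Sum>x\<in>O'. card (N x)))"
    unfolding Csplit using fB fO vB disj by (simp add: sum.union_disjoint d_def B_def)
  then have total: "(\<Sum>u\<in>C. card (N u)) \<le> 2 * d + E + 2 * q" using sumB sumO by simp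
  have def_eq: "deficiency C = (int n - 2) * int (card C) - int (\<Sum>u\<in>C. card (N u))"
    by (simp add: deficiency_def sum_subtractf sum.distrib algebra_simps)
  have def_ge: "(int n - 2) * (1 + int d + int q) - (2 * int d + int E + 2 * int q) \<le> deficiency C"
  proof -
    have "int (\<Sum>u\<in>C. card (N u)) \<le> 2 * int d + int E + 2 * int q" using total by linarith
    moreover have "int (card C) = 1 + int d + int q" using cC by simp
    ultimately show ?thesis unfolding def_eq by simp
  qed
  show ?thesis
  proof (cases "n - 1 \<le> d")
    case True
    \<comment> \<open>Two neighbours \<open>y\<close>, \<open>z\<close> of \<open>b\<close> inside
      \<open>B\<close> would give the path \<open>v, y, b, z\<close>, which uses only three of at
      least \<open>n - 1\<close> neighbours of \<open>v\<close>.\<close>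
    have "card (N b \<inter> B) \<le> 1" if b: "b \<in> B" for b
    proof (rule ccontr)
      assume "\<not> ?thesis"
      then have "2 \<le> card (N b \<inter> B)" by simp
      then obtain y z where yz: "y \<in> N b \<inter> B" "z \<in> N b \<inter> B" "y \<noteq> z"
        by (metis card_2_iff' card_le_Suc0_iff_eq finite_Int finite_N not_less_eq_eq numeral_2_eq_2)
      have neq: "b \<noteq> v" "z \<noteq> v" "b \<noteq> y" "b \<noteq> z" using yz b vB N_irrefl by auto
      have "card (N v - {y, b, z}) < n - 4"
        by (rule no_tree) (use yz b neq N_sym in \<open>auto simp: B_def\<close>)
      moreover have "card (N v - {y, b, z}) = card (N v) - 3"
        using yz b neq by (subst card_Diff_subset) (auto simp: B_def)
      ultimately show False using True by (simp add: d_def B_def)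
    qed
    then have "E \<le> (\<Sum>b\<in>B. 1)" unfolding E_def by (intro sum_mono)
    then have "E \<le> d" by (simp add: d_def)
    have "0 \<le> (int n - 8) * (1 + int d + int q)" using n by simp
    moreover have "int n \<le> 1 + int d + int q" using big cC by simp
    ultimately show ?thesis using def_ge \<open>E \<le> d\<close> cC by (simp add: algebra_simps)
  next
    case False
    then have d: "d = n - 2" using deg by (simp add: d_def B_def)
    then have "1 \<le> q" using cC big n by simp
    then obtain x where x: "x \<in> O'" by (metis card.empty equals0I not_one_le_zero q_def)
    then obtain b where b: "b \<in> B" "N x = {b}" using outer by blast
    \<comment> \<open>Such a \<open>u\<close> in \<open>B\<close> would give the path
      \<open>v, u, b, x\<close> ending in the pendant vertex \<open>x\<close>; it uses only two of
      the \<open>n - 2\<close> neighbours of \<open>v\<close>.\<close>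
    have isol: "u \<notin> B" if u: "u \<in> N b" for u
    proof
      assume uB: "u \<in> B"
      have neq: "b \<noteq> v" "x \<noteq> v" "u \<noteq> b" "x \<noteq> u" using b x uB u vB N_irrefl disj by auto
      have "card (N v - {u, b, x}) < n - 4"
        by (rule no_tree) (use b u uB neq N_sym in \<open>auto simp: B_def\<close>)
      moreover have "N v - {u, b, x} = N v - {u, b}" using x disj by (auto simp: B_def)
      moreover have "card (N v - {u, b}) = card (N v) - 2"
        using uB b neq by (subst card_Diff_subset) (auto simp: B_def)
      ultimately show False using deg by simp
    qed
    have bound: "card (N c \<inter> B) \<le> d - 2" if c: "c \<in> B - {b}" for c
    proof -
      have "b \<notin> N c" using isol[of c] c N_sym[of b c] by blast
      then have "N c \<inter> B \<subseteq> B - {b, c}" using N_irrefl by auto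
      then have "card (N c \<inter> B) \<le> card (B - {b, c})" using fB by (intro card_mono) auto
      moreover have "{b, c} \<subseteq> B" "card {b, c} = 2" using c b(1) by auto
      then have "card (B - {b, c}) = card B - 2" by (simp add: card_Diff_subset)
      ultimately show ?thesis by (simp add: d_def)
    qed
    have "N b \<inter> B = {}" using isol by blast
    moreover have "E = card (N b \<inter> B) + (\<Sum>c\<in>B - {b}. card (N c \<inter> B))"
      unfolding E_def using fB b by (simp add: sum.remove)
    moreover have "(\<Sum>c\<in>B - {b}. card (N c \<inter> B)) \<le> (\<Sum>c\<in>B - {b}. d - 2)"
      by (intro sum_mono bound)
    ultimately have "E \<le> (\<Sum>c\<in>B - {b}. d - 2)" by simp
    then have "E \<le> (d - 1) * (d - 2)" using fB b by (simp add: d_def)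
    moreover have dd: "int d = int n - 2" "int (d - 1) = int n - 3" "int (d - 2) = int n - 4"
      using d n by auto
    ultimately have E: "int E \<le> (int n - 3) * (int n - 4)"
      by (metis of_nat_le_iff of_nat_mult)
    have "7 * int q \<le> int n * int q" using n by (intro mult_right_mono) auto
    moreover have "6 + int n * int n + int n * int q \<le> int E + deficiency C + int n * 5 + int q * 4"
      using def_ge unfolding dd(1) by (simp add: algebra_simps)
    moreover have "int E + int n * 7 \<le> int n * int n + 12" using E by (simp add: algebra_simps)
    moreover have "int (card C) = int n - 1 + int q" using cC dd(1) by simp
    ultimately show ?thesis using \<open>1 \<le> q\<close> by linarith
  qed
qed

lemma component_cases:
  assumes C: "component C" and big: "n \<le> card C"
  obtains "int (card C) + int n - 3 \<le> deficiency C"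
  | "\<And>v. v \<in> C \<Longrightarrow> card (N v) \<le> n - 3"
proof (cases "\<exists>v\<in>C. n - 2 \<le> card (N v)")
  case True
  then show thesis using that(1) deficiency_large_degree[OF C big] by blast
next
  case False
  have "card (N v) \<le> n - 3" if "v \<in> C" for v
  proof -
    have "\<not> n - 2 \<le> card (N v)" using False that by blast
    then show ?thesis by linarith
  qed
  then show thesis using that(2) by blast
qed

lemma deficiency_big_component:
  assumes C: "component C" and big: "n \<le> card C"
  shows "int (card C) \<le> deficiency C"
proof (cases rule: component_cases[OF C big])
  case 1
  then show ?thesis using n by simp
next
  case 2
  then have "(\<Sum>v\<in>C. 1) \<le> deficiency C"
    unfolding deficiency_def using n by (intro sum_mono) force
  then show ?thesis by simp
qed

text \<open>\<open>s\<close> counts the non-neighbours, itself included, of a vertex of degree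
  \<open>n - 3\<close>. If no degree is larger, each vertex has deficiency one plus its loss, and
  \<open>loss_lower_bound\<close> applies to the sets \<open>C - N v\<close>.\<close>

lemma deficiency_critical_component:
  assumes C: "component C" and card: "card C = n - 3 + s" and s: "3 \<le> s" "s + 1 \<le> n - 3"
  defines "m \<equiv> (n - 3) mod s"
  shows "int (card C) + int (min (m * (s - m)) (s + m)) \<le> deficiency C"
proof -
  have big: "n \<le> card C" using card s by simp
  \<comment> \<open>If a larger degree occurs, the extra deficiency \<open>n - 3\<close> of that
    case covers the second entry of the minimum.\<close>
  have "s + m \<le> n - 3"
  proof -
    have "1 \<le> (n - 3) div s" using s by (simp add: div_greater_zero_iff Suc_leI)
    then have "s * 1 \<le> s * ((n - 3) div s)" by (intro mult_le_mono2)
    then show ?thesis unfolding m_def using mult_div_mod_eq[of s "n - 3"] by linarith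
  qed
  show ?thesis
  proof (cases rule: component_cases[OF C big])
    case 1
    then show ?thesis using \<open>s + m \<le> n - 3\<close> n by linarith
  next
    case 2
    have cl: "closed_set C" using C by (simp add: component_def)
    have fC: "finite C" using closed_set_finite cl by blast
    have cM: "card (C - N v) = n - 3 + s - card (N v)" if "v \<in> C" for v
      using cl that card by (subst card_Diff_subset) (auto simp: closed_set_def)
    have "min (m * (s - m)) (s + m) \<le> (\<Sum>v\<in>C. card (C - N v) - s)"
    proof -
      have "card C mod s = m" using card by (simp add: m_def)
      moreover have "min (card C mod s * (s - card C mod s)) (s + card C mod s)
          \<le> (\<Sum>v\<in>C. card (C - N v) - s)"
      proof (rule loss_lower_bound[OF fC])
        show "0 < s" using s by simp
        show "v \<in> C - N v" if "v \<in> C" for v using that N_irrefl by blast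
        show "u \<in> C - N v \<longleftrightarrow> v \<in> C - N u" if "u \<in> C" "v \<in> C" for u v
          using that N_sym[of u v] N_sym[of v u] by blast
        show "s \<le> card (C - N v)" if "v \<in> C" for v using cM[OF that] 2[OF that] by simp
        show "y \<in> C - N x" if "v \<in> C" "card (C - N v) = s" "x \<in> C - N v" "y \<in> C - N v" for v x y
        proof -
          have "n - 3 \<le> card (N v)" using cM[OF that(1)] that(2) s by linarith
          then show ?thesis using nonneighbours_independent[OF C that(1) _ that(3,4)] that by blast
        qed
      qed auto
      ultimately show ?thesis by simp
    qed
    moreover have "deficiency C = int (card C) + int (\<Sum>v\<in>C. card (C - N v) - s)"
    proof -
      have "int n - 2 - int (card (N v)) = 1 + int (card (C - N v) - s)" if "v \<in> C" for v
        using cM[OF that] 2[OF that] n by linarith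
      then have "deficiency C = (\<Sum>v\<in>C. 1 + int (card (C - N v) - s))"
        unfolding deficiency_def by (intro sum.cong) auto
      then show ?thesis by (simp add: sum.distrib)
    qed
    ultimately show ?thesis by linarith
  qed
qed

end

section \<open>Upper bound\<close>

text \<open>The deficiency of copies of \<open>K\<^sub>k\<close> together with one further clique on \<open>a mod k\<close>
  vertices, for \<open>k = n - 1\<close>.\<close>

definition residue_gap :: "nat \<Rightarrow> nat \<Rightarrow> nat" where
  "residue_gap k a = (a mod k) * (k - a mod k)"

section \<open>Arithmetic of residues\<close>

text \<open>For residues \<open>x\<close>, \<open>y\<close> the right side exceeds the left by
  \<open>2 * x * y\<close> if \<open>x + y < k\<close>, and by \<open>2 * (k - x) * (k - y)\<close>
  otherwise.\<close>

lemma residue_gap_add_le: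
  assumes "0 < k"
  shows "residue_gap k (a + b) \<le> residue_gap k a + residue_gap k b"
proof -
  define x y where "x = a mod k" and "y = b mod k"
  have lt: "x < k" "y < k" using assms by (auto simp: x_def y_def)
  then have int_lt: "int (k - x) = int k - int x" "int (k - y) = int k - int y" by auto
  have mod: "(a + b) mod k = (x + y) mod k" by (simp add: x_def y_def mod_add_eq)
  have "int ((x + y) mod k * (k - (x + y) mod k)) \<le> int (x * (k - x)) + int (y * (k - y))"
  proof (cases "x + y < k")
    case True
    then have "int (k - (x + y)) = int k - int x - int y" by simp
    then have eq: "int ((x + y) mod k * (k - (x + y) mod k)) = (int x + int y) * (int k - int x - int y)"
      using True by simp
    have "0 \<le> int x * int y" by simp
    then show ?thesis unfolding eq using int_lt by (simp add: algebra_simps)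
  next
    case False
    then have m: "(x + y) mod k = x + y - k" using lt by (simp add: mod_if)
    have "int (x + y - k) = int x + int y - int k" "int (k - (x + y - k)) = 2 * int k - int x - int y"
      using False lt by auto
    then have eq: "int ((x + y) mod k * (k - (x + y) mod k))
        = (int x + int y - int k) * (2 * int k - int x - int y)"
      unfolding m of_nat_mult by simp
    have "0 \<le> (int k - int x) * (int k - int y)" using lt by simp
    then show ?thesis unfolding eq using int_lt by (simp add: algebra_simps)
  qed
  then show ?thesis unfolding residue_gap_def mod x_def[symmetric] y_def[symmetric]
    by (metis of_nat_add of_nat_le_iff)
qed

lemma residue_le_gap: "0 < k \<Longrightarrow> a mod k \<le> residue_gap k a"
  unfolding residue_gap_def
  by (metis Suc_leI mod_less_divisor mult.right_neutral mult_le_mono2 zero_less_diff One_nat_def)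

lemma residue_sum:
  fixes a b k r :: nat
  assumes "(a + b) mod k = r" "a < k" "b < k"
  shows "a + b = r \<or> a + b = r + k"
  using assms by (cases "a + b < k") (auto simp: le_mod_geq)

text \<open>Compares two ways to place the \<open>r\<close> surplus vertices: as a separate clique,
  or within one component on \<open>n - 1 + r\<close> vertices. The deficiency bound of the latter
  is never larger.\<close>

lemma gap_critical:
  fixes n r :: nat
  assumes "11 \<le> n" "2 \<le> r" "r \<le> n - 6"
  defines "s \<equiv> r + 2" and "m \<equiv> (n - 3) mod (r + 2)"
  shows "s + m \<le> n - 3" "n - 1 + r + min (m * (s - m)) (s + m) \<le> r * (n - 1 - r)"
proof -
  have "1 \<le> (n - 3) div s" using assms by (simp add: div_greater_zero_iff Suc_leI)
  then have "s * 1 \<le> s * ((n - 3) div s)" by (intro mult_le_mono2)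
  then show sm: "s + m \<le> n - 3"
    using mult_div_mod_eq[of s "n - 3"] unfolding m_def s_def[symmetric] by linarith
  have "m < s" by (simp add: m_def s_def)
  consider "r = 2" | "r = 3" | "4 \<le> r" using assms by linarith
  then show "n - 1 + r + min (m * (s - m)) (s + m) \<le> r * (n - 1 - r)"
  proof cases
    case 1
    then have "m = 0 \<or> m = 1 \<or> m = 2 \<or> m = 3" using \<open>m < s\<close> by (auto simp: s_def)
    \<comment> \<open>With the bound 4 on the minimum, the claim for \<open>r = 2\<close> becomes
      exactly \<open>11 <= n\<close>.\<close>
    then have "m * (s - m) \<le> 4" using 1 by (auto simp: s_def)
    then have "min (m * (s - m)) (s + m) \<le> 4" by simp
    then show ?thesis unfolding 1 using assms(1) by linarith
  next
    case 2
    then have "m = 0 \<or> m = 1 \<or> m = 2 \<or> m = 3 \<or> m = 4" using \<open>m < s\<close> by (auto simp: s_def)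
    then have "m * (s - m) \<le> 6" using 2 by (auto simp: s_def)
    then have "min (m * (s - m)) (s + m) \<le> 6" by simp
    then show ?thesis unfolding 2 using assms(1) by linarith
  next
    case 3
    \<comment> \<open>Once the minimum is bounded by \<open>n - 3\<close>, the difference of the two
      sides is this product plus \<open>2 * n - 20\<close>.\<close>
    have "0 \<le> (int r - 4) * (int n - 6 - int r)" using 3 assms(1,3) by (intro mult_nonneg_nonneg) auto
    then have "2 * int n - 4 + int r \<le> int r * (int n - 1 - int r)"
      using assms(1) by (simp add: algebra_simps)
    moreover have "int (r * (n - 1 - r)) = int r * (int n - 1 - int r)"
      using assms(1,3) by (simp add: of_nat_diff)
    moreover have "int (2 * n - 4 + r) = 2 * int n - 4 + int r" using assms(1) by (simp add: of_nat_diff)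
    ultimately have "2 * n - 4 + r \<le> r * (n - 1 - r)" by (metis of_nat_le_iff)
    then show ?thesis using sm assms(1) by linarith
  qed
qed

section \<open>Combining the components\<close>

context tree_free
begin

text \<open>A component with fewer than \<open>n\<close> vertices pays at least the residue gap of
  its size; subadditivity adds these up while components are peeled off.\<close>

lemma closed_set_dichotomy:
  assumes "closed_set C"
  shows "int (residue_gap (n - 1) (card C)) \<le> deficiency C \<or>
    (\<exists>K. component K \<and> K \<subseteq> C \<and> n \<le> card K)"
  using assms
proof (induction "card C" arbitrary: C rule: less_induct)
  case less
  show ?case
  proof (cases "C = {}")
    case True
    then show ?thesis by (simp add: residue_gap_def deficiency_def)
  next
    case False
    then obtain K where K: "component K" "K \<subseteq> C" using ex_component less.prems by blast
    then have cl: "closed_set K" "closed_set (C - K)" and "K \<noteq> {}"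
      using less.prems closed_set_Diff by (auto simp: component_def)
    show ?thesis
    proof (cases "n \<le> card K")
      case True
      then show ?thesis using K by blast
    next
      case small: False
      have card: "card C = card K + card (C - K)" using card_Diff_closed_set[OF less.prems K(2)] .
      moreover have "card K \<noteq> 0" using cl(1) closed_set_finite \<open>K \<noteq> {}\<close> by simp
      ultimately have "card (C - K) < card C" by simp
      from less.hyps[OF this cl(2)] show ?thesis
      proof
        assume rest: "int (residue_gap (n - 1) (card (C - K))) \<le> deficiency (C - K)"
        have "residue_gap (n - 1) (card K) = card K * (n - 1 - card K)"
          using small by (cases "card K = n - 1") (auto simp: residue_gap_def)
        then have "int (residue_gap (n - 1) (card K)) \<le> deficiency K"
          using deficiency_small[OF cl(1)] small by simp
        moreover have "residue_gap (n - 1) (card C)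
            \<le> residue_gap (n - 1) (card K) + residue_gap (n - 1) (card (C - K))"
          unfolding card by (rule residue_gap_add_le) (use n in simp)
        ultimately show ?thesis
          using rest deficiency_Diff[OF less.prems cl(1) K(2)] by linarith
      qed blast
    qed
  qed
qed

text \<open>A cruder bound for what remains beside a chosen large component. A further large
  component \<open>K\<close> pays \<open>card K\<close>, hence at least \<open>n - 1\<close> plus
  its residue, and the rest pays at least its own residue.\<close>

lemma deficiency_closed_set:
  assumes "closed_set C"
  shows "int (residue_gap (n - 1) (card C)) \<le> deficiency C \<or>
    int (n - 1 + card C mod (n - 1)) \<le> deficiency C"
  using assms
proof (induction "card C" arbitrary: C rule: less_induct)
  case less
  have pos: "0 < n - 1" using n by simp
  show ?case
  proof (cases "\<exists>K. component K \<and> K \<subseteq> C \<and> n \<le> card K")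
    case False
    then show ?thesis using closed_set_dichotomy[OF less.prems] by blast
  next
    case True
    then obtain K where K: "component K" "K \<subseteq> C" "n \<le> card K" by blast
    then have cl: "closed_set K" "closed_set (C - K)"
      using less.prems closed_set_Diff by (auto simp: component_def)
    have card: "card C = card K + card (C - K)" using card_Diff_closed_set[OF less.prems K(2)] .
    then have "card (C - K) < card C" using K(3) n by simp
    from less.hyps[OF this cl(2)]
    have "int (card (C - K) mod (n - 1)) \<le> deficiency (C - K)"
      using residue_le_gap[OF pos, of "card (C - K)"] by linarith
    moreover have "n - 1 + card K mod (n - 1) \<le> card K"
    proof -
      have "1 \<le> card K div (n - 1)" using K(3) pos by (simp add: div_greater_zero_iff Suc_leI)
      then have "(n - 1) * 1 \<le> (n - 1) * (card K div (n - 1))" by (intro mult_le_mono2)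
      then show ?thesis using mult_div_mod_eq[of "n - 1" "card K"] by linarith
    qed
    moreover have "card C mod (n - 1) \<le> card K mod (n - 1) + card (C - K) mod (n - 1)"
      unfolding card by (metis mod_add_eq mod_less_eq_dividend)
    ultimately show ?thesis
      using deficiency_big_component[OF K(1,3)] deficiency_Diff[OF less.prems cl(1) K(2)] by linarith
  qed
qed

text \<open>Without a large component, \<open>gap_critical\<close> suffices. With one, every
  configuration other than \<open>card K = k + r\<close>, \<open>c = 0\<close> costs at least
  \<open>2 * k - 2 + r\<close>, while the target is \<open>k + r + L\<close> with
  \<open>L <= k - 2\<close>.\<close>

lemma deficiency_total:
  assumes p: "card V mod (n - 1) = r" and r: "2 \<le> r" "r \<le> n - 6"
  defines "m \<equiv> (n - 3) mod (r + 2)"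
  shows "int (n - 1 + r + min (m * (r + 2 - m)) (r + 2 + m)) \<le> deficiency V"
proof -
  define k where "k = n - 1"
  define L where "L = min (m * (r + 2 - m)) (r + 2 + m)"
  have kn: "n = k + 1" and k: "0 < k" using n by (auto simp: k_def)
  have L: "L \<le> k - 2" "k + r + L \<le> r * (k - r)"
    using gap_critical[OF n r, folded m_def] unfolding L_def k_def by linarith+
  have V: "closed_set V" using N_sub by (simp add: closed_set_def)
  have pk: "card V mod k = r" using p by (simp add: k_def)
  have "int (k + r + L) \<le> deficiency V"
  proof (cases "\<exists>K. component K \<and> K \<subseteq> V \<and> n \<le> card K")
    case False
    then have "int (residue_gap k (card V)) \<le> deficiency V"
      using closed_set_dichotomy[OF V] unfolding k_def by blast
    then show ?thesis using L(2) unfolding residue_gap_def pk by linarith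
  next
    case True
    then obtain K where K: "component K" "K \<subseteq> V" "n \<le> card K" by blast
    define c where "c = card (V - K) mod k"
    define a where "a = card K mod k"
    have cl: "closed_set K" "closed_set (V - K)"
      using K V closed_set_Diff by (auto simp: component_def)
    have "(card K + card (V - K)) mod k = r"
      using pk card_Diff_closed_set[OF V K(2)] by simp
    then have ac: "(a + c) mod k = r" by (simp add: a_def c_def mod_add_eq)
    have lt: "a < k" "c < k" using k by (auto simp: a_def c_def)
    have ge: "a + c = r \<or> a + c = r + k" using residue_sum[OF ac lt] .
    have DK: "int (card K) \<le> deficiency K" using deficiency_big_component[OF K(1,3)] .
    have DV: "deficiency V = deficiency K + deficiency (V - K)"
      using deficiency_Diff[OF V cl(1) K(2)] .
    define j where "j = card K div k"
    have cK: "card K = k * j + a" by (simp add: a_def j_def)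
    have j: "1 \<le> j" using K(3) k by (simp add: j_def kn div_greater_zero_iff Suc_leI)
    have kj: "k \<le> k * j" using j by simp
    have rest: "int (c * (k - c)) \<le> deficiency (V - K) \<or> int (k + c) \<le> deficiency (V - K)"
      using deficiency_closed_set[OF cl(2)] by (simp add: residue_gap_def k_def c_def)
    then show ?thesis
    proof
      assume "int (k + c) \<le> deficiency (V - K)"
      then show ?thesis using DK DV cK kj ge L(1) by linarith
    next
      assume gap: "int (c * (k - c)) \<le> deficiency (V - K)"
      have "1 \<le> k - c" using lt by simp
    then have cgap: "c \<le> c * (k - c)" using mult_le_mono2 by fastforce
      show ?thesis
      proof (cases "j = 1")
        case False
        then have "2 \<le> j" using j by simp
        then have "k * 2 \<le> k * j" by (intro mult_le_mono2)
        then show ?thesis using DK DV cK gap cgap ge L(1) by linarith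
      next
        case True
        then have cK1: "card K = k + a" using cK by simp
        have a: "1 \<le> a" using cK1 K(3) kn by simp
        consider "c = 0" "a = r" | "1 \<le> c" "a + c = r" | "a + c = r + k"
          using ge by fastforce
        then show ?thesis
        proof cases
          case 1
          have "int (card K) + int L \<le> deficiency K"
            using deficiency_critical_component[OF K(1), of "r + 2"] r n cK1 1
            by (simp add: L_def m_def kn)
          then show ?thesis using DV gap cK1 1 by simp
        next
          case 2
          \<comment> \<open>The product is \<open>c * (k - c) - (k - 2 + c)\<close>: splitting
            \<open>r\<close> between \<open>K\<close> and the remainder is too expensive.\<close>
          have "0 \<le> (int c - 1) * (int k - 2 - int c)"
            using 2 a r n by (intro mult_nonneg_nonneg) (auto simp: kn)
          then have "int k - 2 + int c \<le> int c * (int k - int c)" by (simp add: algebra_simps)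
          moreover have "int (c * (k - c)) = int c * (int k - int c)" using lt by (simp add: of_nat_diff)
          ultimately show ?thesis using DK DV cK1 gap 2 L(1) k r n kn by linarith
        next
          case 3
          \<comment> \<open>Here \<open>a = r + k - c\<close> exceeds \<open>r\<close>, so
            \<open>k - 1\<close> from the remainder suffices.\<close>
          have "0 \<le> (int c - 1) * (int k - 1 - int c)"
            using 3 lt r by (intro mult_nonneg_nonneg) auto
          then have "int k - 1 \<le> int c * (int k - int c)" by (simp add: algebra_simps)
          moreover have "int (c * (k - c)) = int c * (int k - int c)" using lt by (simp add: of_nat_diff)
          ultimately show ?thesis using DK DV cK1 gap 3 L(1) lt by linarith
        qed
      qed
    qed
  qed
  then show ?thesis by (simp add: k_def L_def)
qed

end

lemma edges_upper_bound:
  fixes V :: "'a set"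
  assumes n: "11 \<le> n" and V: "finite V" "E \<subseteq> [V]\<^bsup>2\<^esup>" and free: "\<not> contains_subgraph (V, E) (T_star n)"
    and p: "card V mod (n - 1) = r" and r: "2 \<le> r" "r \<le> n - 6"
  defines "m \<equiv> (n - 3) mod (r + 2)"
  shows "2 * card E + (n - 1 + r + min (m * (r + 2 - m)) (r + 2 + m)) \<le> (n - 2) * card V"
proof -
  interpret tree_free V "nbrs E" n
  proof
    show "finite V" by fact
    show "nbrs E v \<subseteq> V" for v using nbrs_subset[OF V(2)] .
    show "v \<in> nbrs E u" if "u \<in> nbrs E v" for u v using that nbrs_sym[of u E v] by simp
    show "v \<notin> nbrs E v" for v using nbrs_irrefl[OF V(2)] .
    show "11 \<le> n" by fact
    show "card (nbrs E c - {b, x, y}) < n - 4"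
      if "b \<in> nbrs E c" "x \<in> nbrs E b" "y \<in> nbrs E x" "x \<noteq> c" "y \<noteq> c" "y \<noteq> b" for b c x y
      by (rule ccontr) (use T_star_subgraphI[OF V _ that, where n = n] free n in simp)
  qed
  have "deficiency V = int (n - 2) * int (card V) - int (\<Sum>v\<in>V. card (nbrs E v))"
    using n by (simp add: deficiency_def sum_subtractf sum.distrib algebra_simps of_nat_diff)
  also have "\<dots> = int ((n - 2) * card V) - int (2 * card E)" unfolding handshake[OF V] by simp
  finally show ?thesis using deficiency_total[OF p r] unfolding m_def by linarith
qed

section \<open>Extremal graphs\<close>

text \<open>The tree is connected, so its image cannot leave a set that no edge of \<open>E\<close>
  crosses.\<close>

lemma contained_T_star_within:
  assumes n: "4 \<le> n" and f: "\<And>e. e \<in> edges (T_star n) \<Longrightarrow> f ` e \<in> E"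
    and E: "\<And>e. e \<in> E \<Longrightarrow> e \<subseteq> A \<or> e \<inter> A = {}" and f0: "f 0 \<in> A"
  shows "f ` verts (T_star n) \<subseteq> A"
proof -
  have step: "f j \<in> A" if "f i \<in> A" "{i, j} \<in> edges (T_star n)" for i j
    using E[OF f[OF that(2)]] that(1) by auto
  have 1: "f i \<in> A" if "i \<in> {1..n - 3}" for i
    by (rule step[OF f0]) (use that in \<open>auto simp: T_star_def\<close>)
  have 2: "f (n - 2) \<in> A"
    by (rule step[OF 1[of "n - 3"]]) (use n in \<open>auto simp: T_star_def\<close>)
  have 3: "f (n - 1) \<in> A"
    by (rule step[OF 2]) (use n in \<open>auto simp: T_star_def\<close>)
  have "verts (T_star n) \<subseteq> {0, n - 2, n - 1} \<union> {1..n - 3}" by (auto simp: verts_T_star)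
  then show ?thesis using f0 1 2 3 by blast
qed

lemma add_clique_free:
  fixes V B :: "'a set"
  assumes n: "4 \<le> n" and E: "E \<subseteq> [V]\<^bsup>2\<^esup>" and free: "\<not> contains_subgraph (V, E) (T_star n)"
    and B: "finite B" "B \<inter> V = {}" "card B < n"
  shows "\<not> contains_subgraph (V \<union> B, E \<union> [B]\<^bsup>2\<^esup>) (T_star n)"
proof
  assume "contains_subgraph (V \<union> B, E \<union> [B]\<^bsup>2\<^esup>) (T_star n)"
  then obtain f where f: "inj_on f (verts (T_star n))" "f ` verts (T_star n) \<subseteq> V \<union> B"
    "\<And>e. e \<in> edges (T_star n) \<Longrightarrow> f ` e \<in> E \<union> [B]\<^bsup>2\<^esup>"
    unfolding contains_subgraph_def by auto
  have EV: "e \<subseteq> V" if "e \<in> E" for e using E that by (auto simp: nsets_def)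
  have EB: "e \<subseteq> B" if "e \<in> [B]\<^bsup>2\<^esup>" for e using that by (auto simp: nsets_def)
  have "0 \<in> verts (T_star n)" by (simp add: verts_T_star)
  then have "f 0 \<in> V \<union> B" using f(2) by blast
  then show False
  proof
    assume f0: "f 0 \<in> B"
    have sep: "e \<subseteq> B \<or> e \<inter> B = {}" if "e \<in> E \<union> [B]\<^bsup>2\<^esup>" for e
      using that EV[of e] EB[of e] B(2) by blast
    have "f ` verts (T_star n) \<subseteq> B" by (rule contained_T_star_within[OF n]) (fact f(3) sep f0)+
    then have "card (verts (T_star n)) \<le> card B" using f(1) B(1) card_inj_on_le by blast
    then show False using B(3) n by (simp add: verts_T_star)
  next
    assume f0: "f 0 \<in> V"
    have sep: "e \<subseteq> V \<or> e \<inter> V = {}" if "e \<in> E \<union> [B]\<^bsup>2\<^esup>" for e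
      using that EV[of e] EB[of e] B(2) by blast
    have V: "f ` verts (T_star n) \<subseteq> V" by (rule contained_T_star_within[OF n]) (fact f(3) sep f0)+
    have "f ` e \<in> E" if e: "e \<in> edges (T_star n)" for e
    proof -
      have "e \<subseteq> verts (T_star n)" "e \<noteq> {}" using e n by (auto simp: T_star_def)
      then have "f ` e \<subseteq> V" "f ` e \<noteq> {}" using V by auto
      then show ?thesis using f(3)[OF e] EB[of "f ` e"] B(2) by blast
    qed
    then show False using free f(1) V unfolding contains_subgraph_def fst_conv snd_conv by blast
  qed
qed

lemma card_add_clique:
  assumes V: "finite V" "E \<subseteq> [V]\<^bsup>2\<^esup>" and B: "finite B" "B \<inter> V = {}"
  shows "2 * card (E \<union> [B]\<^bsup>2\<^esup>) = 2 * card E + card B * (card B - 1)"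
proof -
  have "E \<inter> [B]\<^bsup>2\<^esup> = {}"
  proof -
    have False if "e \<in> E \<inter> [B]\<^bsup>2\<^esup>" for e
    proof -
      have "e \<subseteq> V \<inter> B" "card e = 2" using that V(2) by (auto simp: nsets_def)
      then show False using B(2) by (simp add: Int_commute)
    qed
    then show ?thesis by blast
  qed
  then have "card (E \<union> [B]\<^bsup>2\<^esup>) = card E + card ([B]\<^bsup>2\<^esup>)"
    using finite_edges[OF V] B(1) finite_imp_finite_nsets by (intro card_Un_disjoint) auto
  moreover have "2 * card ([B]\<^bsup>2\<^esup>) = card B * (card B - 1)"
  proof -
    have "even (card B * (card B - 1))" by (cases "card B") auto
    then show ?thesis using B(1) by (simp add: card_nsets choose_two)
  qed
  ultimately show ?thesis by simp
qed

lemma fresh_vertices: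
  fixes V :: "nat set"
  assumes "finite V"
  obtains B where "finite B" "B \<inter> V = {}" "card B = s"
proof -
  have "infinite (UNIV - V)" using assms by (simp add: Diff_infinite_finite)
  then show thesis using infinite_arbitrarily_large[of "UNIV - V" s] that by blast
qed

lemma add_cliques:
  fixes V :: "nat set"
  assumes n: "4 \<le> n" and V: "finite V" "E \<subseteq> [V]\<^bsup>2\<^esup>" and free: "\<not> contains_subgraph (V, E) (T_star n)"
  shows "\<exists>(V' :: nat set) E'. finite V' \<and> E' \<subseteq> [V']\<^bsup>2\<^esup> \<and> \<not> contains_subgraph (V', E') (T_star n) \<and>
    card V' = card V + j * (n - 1) \<and> 2 * card E' = 2 * card E + j * ((n - 1) * (n - 2))"
proof (induction j)
  case 0
  then show ?case using V free by auto
next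
  case (Suc j)
  then obtain V' :: "nat set" and E' where V': "finite V'" "E' \<subseteq> [V']\<^bsup>2\<^esup>"
    "\<not> contains_subgraph (V', E') (T_star n)" "card V' = card V + j * (n - 1)"
    "2 * card E' = 2 * card E + j * ((n - 1) * (n - 2))" by blast
  obtain B where B: "finite B" "B \<inter> V' = {}" "card B = n - 1" using fresh_vertices[OF V'(1)] .
  have "card B < n" using B(3) n by simp
  note free' = add_clique_free[OF n V'(2,3) B(1,2) this]
  have "2 * card (E' \<union> [B]\<^bsup>2\<^esup>) = 2 * card E' + (n - 1) * (n - 2)"
    using card_add_clique[OF V'(1,2) B(1,2)] B(3) by (simp add: numeral_2_eq_2)
  moreover have "card (V' \<union> B) = card V' + (n - 1)"
    using V'(1) B by (subst card_Un_disjoint) auto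
  moreover have "E' \<union> [B]\<^bsup>2\<^esup> \<subseteq> [V' \<union> B]\<^bsup>2\<^esup>"
    using V'(2) by (auto simp: nsets_def)
  ultimately show ?case using V' B(1) free'
    by (intro exI[of _ "V' \<union> B"] exI[of _ "E' \<union> [B]\<^bsup>2\<^esup>"]) auto
qed

text \<open>A maximum degree condition that, unlike the absence of \<open>T\<^sub>n\<^sup>*\<close> itself, makes sense for
  every \<open>d\<close> and survives joins with independent sets.\<close>

definition tame :: "nat \<Rightarrow> 'a set \<Rightarrow> 'a set set \<Rightarrow> bool" where
  "tame d V E \<longleftrightarrow> finite V \<and> E \<subseteq> [V]\<^bsup>2\<^esup> \<and>
     (\<forall>v\<in>V. card (nbrs E v) < d \<or> card (nbrs E v) = d \<and>
        (\<forall>x\<in>V - nbrs E v. \<forall>y\<in>V - nbrs E v. {x, y} \<notin> E))"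

text \<open>The centre needs \<open>n - 3\<close> neighbours, the maximum possible, so the tree
  exhausts its neighbourhood; the last edge of the tree would then join two non-neighbours.\<close>

lemma tame_imp_free:
  assumes n: "4 \<le> n" and tame: "tame (n - 3) V E"
  shows "\<not> contains_subgraph (V, E) (T_star n)"
proof
  assume "contains_subgraph (V, E) (T_star n)"
  then obtain f where f: "inj_on f {0..n - 1}" "f ` {0..n - 1} \<subseteq> V"
    "\<And>e. e \<in> edges (T_star n) \<Longrightarrow> f ` e \<in> E"
    unfolding contains_subgraph_def verts_T_star by auto
  have E: "E \<subseteq> [V]\<^bsup>2\<^esup>" and V: "finite V" using tame by (auto simp: tame_def)
  have finN: "finite (nbrs E (f 0))" using nbrs_subset[OF E] V finite_subset by blast
  have f0: "f 0 \<in> V" using f(2) by auto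
  have sub: "f ` {1..n - 3} \<subseteq> nbrs E (f 0)"
  proof
    fix u assume "u \<in> f ` {1..n - 3}"
    then obtain i where i: "i \<in> {1..n - 3}" "u = f i" by blast
    then have "{0, i} \<in> edges (T_star n)" by (auto simp: T_star_def)
    from f(3)[OF this] show "u \<in> nbrs E (f 0)" using i by (simp add: nbrs_def insert_commute)
  qed
  have "inj_on f {1..n - 3}" by (rule inj_on_subset[OF f(1)]) auto
  then have "card (f ` {1..n - 3}) = n - 3" by (simp add: card_image)
  moreover from this have "n - 3 \<le> card (nbrs E (f 0))" using card_mono[OF finN sub] by simp
  moreover have "card (nbrs E (f 0)) \<le> n - 3" using tame f0 by (auto simp: tame_def)
  ultimately have full: "card (nbrs E (f 0)) = n - 3" "f ` {1..n - 3} = nbrs E (f 0)"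
    using card_subset_eq[OF finN sub] by simp_all
  have "f i \<in> V - nbrs E (f 0)" if "i \<in> {n - 2, n - 1}" for i
  proof -
    have "i \<in> {0..n - 1}" "i \<notin> {1..n - 3}" "{1..n - 3} \<subseteq> {0..n - 1}" using that n by auto
    then have "f i \<notin> f ` {1..n - 3}" using inj_on_image_mem_iff[OF f(1)] by blast
    then show ?thesis using full f(2) \<open>i \<in> {0..n - 1}\<close> by auto
  qed
  moreover have "f ` {n - 2, n - 1} \<in> E" by (rule f(3)) (simp add: T_star_def)
  ultimately show False using tame f0 full(1) by (auto simp: tame_def)
qed

section \<open>Joins with independent sets\<close>

lemma nbrs_join:
  assumes E: "E \<subseteq> [V]\<^bsup>2\<^esup>" and disj: "B \<inter> V = {}"
  defines "E' \<equiv> E \<union> {{x, y} | x y. x \<in> V \<and> y \<in> B}"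
  shows "v \<in> V \<Longrightarrow> nbrs E' v = nbrs E v \<union> B" "v \<in> B \<Longrightarrow> nbrs E' v = V"
proof -
  have sub: "x \<in> V \<and> y \<in> V" if "{x, y} \<in> E" for x y using E that by (auto simp: nsets_def)
  have mem: "{u, v} \<in> E' \<longleftrightarrow> {u, v} \<in> E \<or> (u \<in> V \<and> v \<in> B) \<or> (v \<in> V \<and> u \<in> B)" for u v
    unfolding E'_def by (auto simp: doubleton_eq_iff)
  show "v \<in> V \<Longrightarrow> nbrs E' v = nbrs E v \<union> B" "v \<in> B \<Longrightarrow> nbrs E' v = V"
    unfolding nbrs_def mem using disj sub by blast+
qed

text \<open>Vertices of \<open>V\<close> keep their non-neighbours. Vertices of \<open>B\<close> get
  degree \<open>card V\<close>, exactly the new bound, and their non-neighbours form the independent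
  set \<open>B\<close>.\<close>

lemma tame_join:
  assumes tame: "tame d V E" and B: "finite B" "B \<inter> V = {}" and card: "card V = d + card B"
  defines "E' \<equiv> E \<union> {{x, y} | x y. x \<in> V \<and> y \<in> B}"
  shows "tame (d + card B) (V \<union> B) E'" "card E' = card E + card V * card B"
proof -
  have V: "finite V" "E \<subseteq> [V]\<^bsup>2\<^esup>" using tame by (auto simp: tame_def)
  define J where "J = {{x, y} | x y. x \<in> V \<and> y \<in> B}"
  have E': "E' = E \<union> J" by (simp add: E'_def J_def)
  have J: "J = (\<lambda>(x, y). {x, y}) ` (V \<times> B)" by (auto simp: J_def)
  have "inj_on (\<lambda>(x, y). {x, y}) (V \<times> B)"
    using B(2) by (auto simp: inj_on_def doubleton_eq_iff)
  then have "card J = card V * card B" unfolding J by (simp add: card_image card_cartesian_product)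
  moreover have "E \<inter> J = {}"
    using V(2) B(2) by (auto simp: J_def nsets_def)
  moreover have "finite J" unfolding J using V B by simp
  ultimately show "card E' = card E + card V * card B"
    unfolding E' using finite_edges[OF V] by (simp add: card_Un_disjoint)
  note nb = nbrs_join[OF V(2) B(2), folded E'_def]
  have mem: "{x, y} \<notin> E'" if "{x, y} \<notin> E" "x \<in> V" "y \<in> V" for x y
    using that B(2) by (auto simp: E'_def doubleton_eq_iff)
  have memB: "{x, y} \<notin> E'" if "x \<in> B" "y \<in> B" for x y
    using that B(2) V(2) by (auto simp: E'_def doubleton_eq_iff nsets_def)
  have "card (nbrs E' v) < d + card B \<or> card (nbrs E' v) = d + card B \<and>
        (\<forall>x\<in>V \<union> B - nbrs E' v. \<forall>y\<in>V \<union> B - nbrs E' v. {x, y} \<notin> E')" if "v \<in> V \<union> B" for v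
  proof (cases "v \<in> V")
    case True
    have "nbrs E v \<inter> B = {}" "finite (nbrs E v)"
      using nbrs_subset[OF V(2)] B(2) V(1) finite_subset by blast+
    then have c: "card (nbrs E' v) = card (nbrs E v) + card B"
      unfolding nb(1)[OF True] using B(1) by (simp add: card_Un_disjoint)
    have "V \<union> B - nbrs E' v = V - nbrs E v" unfolding nb(1)[OF True] using B(2) by blast
    moreover have "card (nbrs E v) < d \<or> card (nbrs E v) = d \<and>
        (\<forall>x\<in>V - nbrs E v. \<forall>y\<in>V - nbrs E v. {x, y} \<notin> E)"
      using tame True by (simp add: tame_def)
    ultimately show ?thesis unfolding c using mem by auto
  next
    case False
    then have nbv: "nbrs E' v = V" using that nb(2) by blast
    have "V \<union> B - V = B" using B(2) by blast
    then show ?thesis unfolding nbv using card memB by simp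
  qed
  moreover have "E' \<subseteq> [V \<union> B]\<^bsup>2\<^esup>"
  proof -
    have "x \<noteq> y" if "x \<in> V" "y \<in> B" for x y using that B(2) by blast
    then show ?thesis using V(2) by (auto simp: E'_def nsets_def card_insert_if)
  qed
  ultimately show "tame (d + card B) (V \<union> B) E'" using V(1) B(1) by (simp add: tame_def)
qed

text \<open>New vertices have full degree and old ones gain as much as the degree bound rises, so
  the loss \<open>L\<close> and the difference \<open>s\<close> between order and degree bound are
  invariant.\<close>

lemma tame_join_iterated:
  fixes V :: "nat set"
  assumes "tame d V E" "card V = d + s" "2 * card E + L = d * card V"
  shows "\<exists>(V' :: nat set) E'. tame (d + q * s) V' E' \<and> card V' = d + q * s + s \<and>
    2 * card E' + L = (d + q * s) * card V'"
proof (induction q)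
  case 0
  then show ?case using assms by (intro exI[of _ V] exI[of _ E]) simp
next
  case (Suc q)
  then obtain V' :: "nat set" and E' where V': "tame (d + q * s) V' E'" "card V' = d + q * s + s"
    "2 * card E' + L = (d + q * s) * card V'" by blast
  have "finite V'" using V'(1) by (simp add: tame_def)
  then obtain B where B: "finite B" "B \<inter> V' = {}" "card B = s" using fresh_vertices by blast
  have "card V' = d + q * s + card B" using V'(2) B(3) by simp
  note J = tame_join[OF V'(1) B(1,2) this]
  have "card (V' \<union> B) = d + Suc q * s + s"
    using V'(2) B \<open>finite V'\<close> by (subst card_Un_disjoint) auto
  moreover have "2 * (card E' + card V' * s) + L = (d + Suc q * s) * (d + Suc q * s + s)"
    using V'(2,3) by (simp add: algebra_simps)
  moreover have "d + q * s + s = d + Suc q * s" by simp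
  ultimately show ?case using J B(3)
    by (intro exI[of _ "V' \<union> B"] exI[of _ "E' \<union> {{x, y} | x y. x \<in> V' \<and> y \<in> B}"]) (simp add: ac_simps)
qed

section \<open>Base graphs on \<open>s + m\<close> vertices\<close>

text \<open>A complete bipartite graph with sides of size \<open>m\<close>, together with
  \<open>s - m\<close> isolated vertices that lose \<open>m\<close> each.\<close>

lemma tame_bipartite:
  assumes "m \<le> s"
  shows "\<exists>E. tame m {..<s + m} E \<and> 2 * card E + m * (s - m) = m * (s + m)"
proof -
  define C where "C = {..<m}"
  define D where "D = {s..<s + m}"
  define E where "E = {{x, y} | x y. x \<in> C \<and> y \<in> D}"
  have mem: "{u, v} \<in> E \<longleftrightarrow> (u \<in> C \<and> v \<in> D) \<or> (v \<in> C \<and> u \<in> D)" for u v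
    unfolding E_def by (auto simp: doubleton_eq_iff)
  have nb: "nbrs E v = (if v \<in> C then D else if v \<in> D then C else {})" for v
    unfolding nbrs_def mem using assms by (auto simp: C_def D_def)
  \<comment> \<open>For \<open>m = 0\<close> the isolated vertices have full degree as well, but
    then there are no edges.\<close>
  have "{x, y} \<notin> E" if "x \<in> {..<s + m} - nbrs E v" "y \<in> {..<s + m} - nbrs E v"
    "card (nbrs E v) = m" for v x y
    using that assms by (cases "m = 0") (auto simp: nb mem C_def D_def split: if_splits)
  moreover have "card (nbrs E v) \<le> m" for v by (simp add: nb C_def D_def)
  moreover have "E \<subseteq> [{..<s + m}]\<^bsup>2\<^esup>"
    using assms by (auto simp: E_def nsets_def C_def D_def card_insert_if)
  ultimately have "tame m {..<s + m} E"
    unfolding tame_def by (auto simp: nat_less_le)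
  moreover have "card E = m * m"
  proof -
    have "E = (\<lambda>(x, y). {x, y}) ` (C \<times> D)" by (auto simp: E_def)
    moreover have "inj_on (\<lambda>(x, y). {x, y}) (C \<times> D)"
      using assms by (auto simp: inj_on_def doubleton_eq_iff C_def D_def)
    ultimately show ?thesis by (simp add: card_image card_cartesian_product C_def D_def)
  qed
  moreover have "2 * (m * m) + m * (s - m) = m * (s + m)"
  proof -
    obtain t where "s = m + t" using assms le_Suc_ex by blast
    then show ?thesis by (simp add: algebra_simps)
  qed
  ultimately show ?thesis by metis
qed

lemma card_rotation_vimage:
  fixes M x :: nat
  assumes "S \<subseteq> {..<M}"
  shows "card {y \<in> {..<M}. (x + y) mod M \<in> S} = card S"
proof (cases "M = 0")
  case True
  then show ?thesis using assms by auto
next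
  case False
  let ?f = "\<lambda>y. (x + y) mod M"
  have inj: "inj_on ?f {..<M}"
  proof (rule inj_onI)
    fix y z assume "y \<in> {..<M}" "z \<in> {..<M}" "(x + y) mod M = (x + z) mod M"
    then show "y = z" using cong_add_lcancel_nat[of x y z M] by (simp add: cong_def)
  qed
  have "?f ` {..<M} = {..<M}"
    by (rule endo_inj_surj) (use False inj in auto)
  moreover have "?f ` {y \<in> {..<M}. ?f y \<in> S} = ?f ` {..<M} \<inter> S" by blast
  ultimately have "?f ` {y \<in> {..<M}. ?f y \<in> S} = S" using assms by (simp add: Int_absorb1)
  moreover have "inj_on ?f {y \<in> {..<M}. ?f y \<in> S}" using inj by (rule inj_on_subset) auto
  ultimately show ?thesis using card_image by metis
qed

lemma nbrs_of_relation:
  assumes "\<And>x y. R x y \<longleftrightarrow> R y x" "x \<in> V"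
  shows "nbrs {{x, y} | x y. x \<in> V \<and> y \<in> V \<and> x \<noteq> y \<and> R x y} x = {y \<in> V. y \<noteq> x \<and> R x y}"
  unfolding nbrs_def using assms(2) by (auto simp: doubleton_eq_iff dest: assms(1)[THEN iffD1])

text \<open>A \<open>k\<close>-regular graph on \<open>{..<M}\<close>, up to one missing degree if \<open>k * M\<close> is odd:
  join \<open>x\<close> and \<open>y\<close> if \<open>(x + y) mod M\<close> is one of \<open>k\<close> prescribed values. For even \<open>M\<close>
  the values are odd, so that \<open>x + x\<close> is never prescribed. For odd \<open>M\<close> they are
  \<open>0, 2, \<dots>, 2k - 2\<close>; then precisely the vertices below \<open>k\<close> lose a loop, and the additional
  edges \<open>{2i, 2i + 1}\<close> make up for this.\<close>

lemma almost_regular_graph: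
  fixes k M :: nat
  assumes "2 * k \<le> M"
  shows "\<exists>E \<subseteq> [{..<M}]\<^bsup>2\<^esup>. (\<forall>v<M. card (nbrs E v) \<le> k) \<and> k * M \<le> 2 * card E + 1"
proof (cases "even M")
  case True
  define S where "S = (\<lambda>i. 2 * i + 1) ` {..<k}"
  define R where "R x y \<longleftrightarrow> (x + y) mod M \<in> S" for x y
  define E where "E = {{x, y} | x y. x \<in> {..<M} \<and> y \<in> {..<M} \<and> x \<noteq> y \<and> R x y}"
  have cS: "card S = k" unfolding S_def by (simp add: card_image inj_on_def)
  have SM: "S \<subseteq> {..<M}" using assms by (auto simp: S_def)
  have "card (nbrs E v) = k" if "v < M" for v
  proof -
    have "nbrs E v = {y \<in> {..<M}. y \<noteq> v \<and> R v y}"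
      unfolding E_def by (rule nbrs_of_relation) (use that in \<open>auto simp: R_def add.commute\<close>)
    moreover have "\<not> R v v"
    proof -
      have "even ((v + v) mod M)" using True by (simp add: dvd_mod_iff)
      then show ?thesis by (auto simp: R_def S_def)
    qed
    ultimately have "nbrs E v = {y \<in> {..<M}. (v + y) mod M \<in> S}" by (auto simp: R_def)
    then show ?thesis using card_rotation_vimage[OF SM, of v] cS by simp
  qed
  moreover have E: "E \<subseteq> [{..<M}]\<^bsup>2\<^esup>" by (auto simp: E_def nsets_def card_insert_if)
  ultimately have "2 * card E = k * M" using handshake[OF _ E] by (simp add: mult.commute)
  then show ?thesis using E \<open>\<And>v. v < M \<Longrightarrow> card (nbrs E v) = k\<close> by (intro exI[of _ E]) auto
next
  case odd: False
  define S where "S = (\<lambda>i. 2 * i) ` {..<k}"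
  define P where "P x y \<longleftrightarrow> x < k \<and> y < k \<and> (even x \<and> y = Suc x \<or> even y \<and> x = Suc y)" for x y
  define R where "R x y \<longleftrightarrow> (x + y) mod M \<in> S \<or> P x y" for x y
  define E where "E = {{x, y} | x y. x \<in> {..<M} \<and> y \<in> {..<M} \<and> x \<noteq> y \<and> R x y}"
  have cS: "card S = k" unfolding S_def by (simp add: card_image inj_on_def)
  have kM: "2 * k < M" using assms odd by (metis dvd_triv_left le_neq_implies_less)
  then have SM: "S \<subseteq> {..<M}" by (auto simp: S_def)
  have S_even: "even \<sigma>" if "\<sigma> \<in> S" for \<sigma> using that by (auto simp: S_def)
  \<comment> \<open>Without reduction, \<open>2 * v\<close> is prescribed exactly for
    \<open>v < k\<close>; reduced once by the odd \<open>M\<close>, it becomes odd.\<close>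
  have loop: "(v + v) mod M \<in> S \<longleftrightarrow> v < k" if "v < M" for v
  proof (cases "v + v < M")
    case True
    then show ?thesis by (auto simp: S_def image_iff mult_2)
  next
    case False
    then have "(v + v) mod M = v + v - M" using that by (simp add: le_mod_geq)
    moreover have "odd (v + v - M)" using odd False by simp
    ultimately have "(v + v) mod M \<notin> S" using S_even by metis
    then show ?thesis using False kM by simp
  qed
  \<comment> \<open>Only \<open>k - 1\<close> can lack a partner, namely for odd \<open>k\<close>;
    this is the single missing degree.\<close>
  have deg: "card (nbrs E v) \<le> k \<and> k \<le> card (nbrs E v) + (if v = k - 1 then 1 else 0)"
    if v: "v < M" for v
  proof -
    define T where "T = {y \<in> {..<M}. (v + y) mod M \<in> S}"
    define Q where "Q = {y. P v y}"
    have cT: "card T = k" unfolding T_def using card_rotation_vimage[OF SM] cS by simp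
    have "nbrs E v = {y \<in> {..<M}. y \<noteq> v \<and> R v y}"
      unfolding E_def by (rule nbrs_of_relation) (use v in \<open>auto simp: R_def P_def add.commute\<close>)
    moreover have "y < M \<and> y \<noteq> v" if "P v y" for y using that kM by (auto simp: P_def)
    ultimately have nb: "nbrs E v = (T - {v}) \<union> Q"
      unfolding T_def Q_def R_def by blast
    have "T \<inter> Q = {}"
    proof -
      have "(v + y) mod M \<notin> S" if "P v y" for y
      proof -
        \<comment> \<open>Partners are consecutive numbers below \<open>k\<close>, so the additional
          edges are new.\<close>
        have "v + y < M" "odd (v + y)" using that kM by (auto simp: P_def)
        then show ?thesis using S_even by (metis mod_less)
      qed
      then show ?thesis unfolding T_def Q_def by blast
    qed
    moreover have "Q \<subseteq> {..<k}" by (auto simp: Q_def P_def)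
    then have fQ: "finite Q" by (rule finite_subset) simp
    moreover have "finite T" by (simp add: T_def)
    ultimately have c: "card (nbrs E v) = card (T - {v}) + card Q"
      unfolding nb by (intro card_Un_disjoint) blast+
    show ?thesis
    proof (cases "v < k")
      case False
      then have "Q = {}" "v \<notin> T" using loop[OF v] by (auto simp: Q_def P_def T_def)
      then show ?thesis using c cT by simp
    next
      case True
      then have "v \<in> T" using loop[OF v] v by (simp add: T_def)
      then have cT': "card (T - {v}) = k - 1" using cT by simp
      have "Q \<subseteq> {if even v then Suc v else v - 1}" by (auto simp: Q_def P_def)
      from card_mono[OF _ this] have "card Q \<le> 1" by simp
      moreover have "card Q \<noteq> 0" if "v \<noteq> k - 1"
      proof -
        have "P v (if even v then Suc v else v - 1)"
          using that True by (auto simp: P_def elim!: oddE)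
        then show ?thesis using fQ by (auto simp: Q_def)
      qed
      ultimately show ?thesis using c cT' True by auto
    qed
  qed
  have E: "E \<subseteq> [{..<M}]\<^bsup>2\<^esup>" by (auto simp: E_def nsets_def card_insert_if)
  have "(\<Sum>v<M. k) \<le> (\<Sum>v<M. card (nbrs E v) + (if v = k - 1 then 1 else 0))"
    by (intro sum_mono) (use deg in auto)
  also have "\<dots> \<le> 2 * card E + 1" using handshake[OF _ E] by (simp add: sum.distrib)
  finally show ?thesis using E deg by (intro exI[of _ E]) (auto simp: mult.commute)
qed

text \<open>Degrees at most \<open>m - 1\<close> satisfy tameness at once, at the price of one unit
  per vertex and possibly one more for parity.\<close>

lemma tame_almost_regular:
  assumes "2 \<le> m" "m \<le> s"
  shows "\<exists>E L. tame m {..<s + m} E \<and> 2 * card E + L = m * (s + m) \<and> L \<le> s + m + 1"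
proof -
  have "2 * (m - 1) \<le> s + m" using assms by simp
  from almost_regular_graph[OF this] obtain E where E: "E \<subseteq> [{..<s + m}]\<^bsup>2\<^esup>" "\<forall>v<s + m. card (nbrs E v) \<le> m - 1"
    "(m - 1) * (s + m) \<le> 2 * card E + 1"
    by blast
  have "tame m {..<s + m} E" using E assms by (force simp: tame_def)
  moreover have "2 * card E \<le> m * (s + m)"
  proof -
    have "(\<Sum>v<s + m. card (nbrs E v)) \<le> (\<Sum>v<s + m. m)"
      by (intro sum_mono) (use E(2) in fastforce)
    then show ?thesis using handshake[OF _ E(1)] by (simp add: mult.commute)
  qed
  moreover have "(m - 1) * (s + m) + (s + m) = m * (s + m)"
    using assms by (metis Suc_diff_1 add.commute less_le_trans mult_Suc pos2)
  ultimately show ?thesis using E(3)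
    by (intro exI[of _ E] exI[of _ "m * (s + m) - 2 * card E"]) simp
qed

section \<open>The extremal number\<close>

lemma turan_numberI:
  fixes L :: "'b graph" and V :: "nat set"
  assumes bound: "\<forall>(W :: nat set) F. finite W \<longrightarrow> F \<subseteq> [W]\<^bsup>2\<^esup> \<longrightarrow> card W = p \<longrightarrow>
      \<not> contains_subgraph (W, F) L \<longrightarrow> 2 * card F + a \<le> b"
    and V: "finite V" "E \<subseteq> [V]\<^bsup>2\<^esup>" "card V = p" "\<not> contains_subgraph (V, E) L"
  shows "2 * turan_number p L + a \<le> b" "card E \<le> turan_number p L"
proof -
  define S where "S = {card (edges G) | G :: nat graph.
      finite_simple_graph G \<and> card (verts G) = p \<and> \<not> contains_subgraph G L}"
  have S_bound: "2 * e + a \<le> b" if "e \<in> S" for e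
    using that bound by (auto simp: S_def finite_simple_graph_def)
  then have "S \<subseteq> {..b}" by fastforce
  then have fin: "finite S" by (rule finite_subset) simp
  have E: "card E \<in> S"
    unfolding S_def using V by (auto simp: finite_simple_graph_def intro!: exI[of _ V] exI[of _ E])
  have T: "turan_number p L = Max S" by (simp add: turan_number_def S_def)
  show "card E \<le> turan_number p L" unfolding T using fin E by (rule Max_ge)
  have "Max S \<in> S" using fin E by (intro Max_in) auto
  then show "2 * turan_number p L + a \<le> b" unfolding T by (rule S_bound)
qed

text \<open>The difference \<open>m * (r + 2 - m) - (r + 2 + m)\<close> equals
  \<open>(m - 2) * (r - 1 - m) + (r - 4)\<close>; outside the first case only a few values of
  \<open>m\<close> remain.\<close>

lemma min_loss:
  fixes m r :: nat
  assumes "2 \<le> r" "m \<le> r + 1"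
  shows "min (m * (r + 2 - m)) (r + 2 + m) =
    (if 4 \<le> r \<and> 2 \<le> m \<and> m \<le> r - 1 then r + 2 + m else m * (r + 2 - m))"
proof (cases "4 \<le> r \<and> 2 \<le> m \<and> m \<le> r - 1")
  case True
  have "0 \<le> (int m - 2) * (int r - 1 - int m)" using True by (intro mult_nonneg_nonneg) auto
  then have "int r + 2 + int m \<le> int m * (int r + 2 - int m)" using True by (simp add: algebra_simps)
  moreover have "int (m * (r + 2 - m)) = int m * (int r + 2 - int m)"
    using assms by (simp add: of_nat_diff)
  moreover have "int (r + 2 + m) = int r + 2 + int m" by simp
  ultimately have "r + 2 + m \<le> m * (r + 2 - m)" by (metis of_nat_le_iff)
  then show ?thesis using True by simp
next
  case False
  then consider "m = 0" | "m = 1" | "m = r" | "m = r + 1" | "r = 3" "m = 2"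
    using assms by linarith
  then have "m * (r + 2 - m) \<le> r + 2 + m" by cases simp_all
  then show ?thesis unfolding if_not_P[OF False] by (rule min_absorb1)
qed

text \<open>Joining the base graph with \<open>q\<close> independent sets raises the degree bound
  from \<open>m\<close> to \<open>n - 3\<close>; then \<open>j\<close> cliques are added. The
  predicate \<open>Q\<close> admits both an exact loss and a mere bound on it.\<close>

lemma extremal_graph:
  assumes n: "4 \<le> n" and base: "\<exists>(E :: nat set set) L. tame m {..<s + m} E \<and> 2 * card E + L = m * (s + m) \<and> Q L"
    and q: "n - 3 = m + q * s"
  shows "\<exists>(V :: nat set) E L. finite V \<and> E \<subseteq> [V]\<^bsup>2\<^esup> \<and> \<not> contains_subgraph (V, E) (T_star n) \<and>
    card V = n - 3 + s + j * (n - 1) \<and>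
    2 * card E + L = (n - 3) * (n - 3 + s) + j * ((n - 1) * (n - 2)) \<and> Q L"
proof -
  from base obtain E0 :: "nat set set" and L
    where E0: "tame m {..<s + m} E0" "2 * card E0 + L = m * (s + m)" "Q L" by blast
  have "card {..<s + m} = m + s" "2 * card E0 + L = m * card {..<s + m}" using E0(2) by simp_all
  from tame_join_iterated[OF E0(1) this, of q] obtain V1 :: "nat set" and E1
    where 1: "tame (n - 3) V1 E1" "card V1 = n - 3 + s" "2 * card E1 + L = (n - 3) * card V1"
    unfolding q by blast
  have V1: "finite V1" "E1 \<subseteq> [V1]\<^bsup>2\<^esup>" using 1(1) by (auto simp: tame_def)
  from add_cliques[OF n V1 tame_imp_free[OF n 1(1)], of j] obtain V2 :: "nat set" and E2
    where "finite V2" "E2 \<subseteq> [V2]\<^bsup>2\<^esup>" "\<not> contains_subgraph (V2, E2) (T_star n)"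
      "card V2 = card V1 + j * (n - 1)" "2 * card E2 = 2 * card E1 + j * ((n - 1) * (n - 2))" by blast
  then show ?thesis using 1(2,3) E0(3)
    by (intro exI[of _ V2] exI[of _ E2] exI[of _ L]) simp
qed

theorem theorem4p4:
  fixes p n r m :: nat
  assumes "11 \<le> n" and "n \<le> p"
    and "r \<in> {2..n - 6}" and "[p = r] (mod (n - 1))"
    and "m \<in> {0..r + 1}" and "[n - 3 = m] (mod (r + 2))"
  shows "real (turan_number p (T_star n)) =
    (if 4 \<le> r \<and> 2 \<le> m \<and> m \<le> r - 1
     then real_of_int \<lfloor>((real n - 2) * (real p - 1) - 2 * real r - real m - 3) / 2\<rfloor>
     else ((real n - 2) * (real p - 1) - real m * (real r + 2 - real m) - real r - 1) / 2)"
proof -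
  have r: "2 \<le> r" "r \<le> n - 6" and mr: "m \<le> r + 1" using assms by auto
  have n4: "4 \<le> n" using assms(1) by simp
  have pr: "p mod (n - 1) = r" using assms(1,4) r by (simp add: cong_def)
  have mm: "(n - 3) mod (r + 2) = m" using assms(6) mr by (simp add: cong_def)
  define t where "t = p div (n - 1)"
  have pt: "p = t * (n - 1) + r" using pr div_mult_mod_eq[of p "n - 1"] by (simp add: t_def)
  have "t \<noteq> 0"
  proof
    assume "t = 0"
    then have "p = r" using pt by simp
    then show False using assms(1,2) r by linarith
  qed
  \<comment> \<open>One of the \<open>t\<close> blocks of size \<open>n - 1\<close> merges with the
    \<open>r\<close> surplus vertices into the component of size
    \<open>n - 3 + (r + 2)\<close>.\<close>
  then obtain j where "t = Suc j" using not0_implies_Suc by blast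
  then have pj: "p = n - 3 + (r + 2) + j * (n - 1)" using pt assms(1) by simp
  define q where "q = (n - 3) div (r + 2)"
  have q: "n - 3 = m + q * (r + 2)" using mm div_mult_mod_eq[of "n - 3" "r + 2"] by (simp add: q_def)
  define a where "a = n - 1 + r + min (m * (r + 2 - m)) (r + 2 + m)"
  define T where "T = turan_number p (T_star n)"
  have bound: "\<forall>(W :: nat set) F. finite W \<longrightarrow> F \<subseteq> [W]\<^bsup>2\<^esup> \<longrightarrow> card W = p \<longrightarrow>
      \<not> contains_subgraph (W, F) (T_star n) \<longrightarrow> 2 * card F + a \<le> (n - 2) * p"
    using edges_upper_bound[OF assms(1) _ _ _ _ r] pr mm unfolding a_def by blast
  \<comment> \<open>The summand \<open>n - 1 + r\<close> is one unit per vertex: the shortfall of an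
    \<open>(n - 3)\<close>-regular component of that size from degree \<open>n - 2\<close>.\<close>
  have total: "(n - 3) * (n - 3 + (r + 2)) + j * ((n - 1) * (n - 2)) + (n - 1 + r) = (n - 2) * p"
  proof -
    have "3 \<le> n" using n4 by simp
    then obtain c where "n = 3 + c" using le_Suc_ex by blast
    then show ?thesis unfolding pj by (simp add: algebra_simps)
  qed
  have real_pred2: "real (n - 2) = real n - 2" and real_pred: "real (n - 1) = real n - 1"
    using n4 by (auto simp: of_nat_diff)
  show ?thesis
  proof (cases "4 \<le> r \<and> 2 \<le> m \<and> m \<le> r - 1")
    case True
    then have "\<exists>E L. tame m {..<r + 2 + m} E \<and> 2 * card E + L = m * (r + 2 + m) \<and> L \<le> r + 2 + m + 1"
      by (intro tame_almost_regular) auto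
    from extremal_graph[OF n4 this q, of j] obtain V :: "nat set" and E L
      where V: "finite V" "E \<subseteq> [V]\<^bsup>2\<^esup>" "card V = p" "\<not> contains_subgraph (V, E) (T_star n)"
        and E: "2 * card E + L = (n - 3) * (n - 3 + (r + 2)) + j * ((n - 1) * (n - 2))" "L \<le> r + 2 + m + 1"
      unfolding pj by blast
    note T = turan_numberI[OF bound V, folded T_def]
    have "a = n - 1 + r + (r + 2 + m)" unfolding a_def min_loss[OF r(1) mr] if_P[OF True] ..
    \<comment> \<open>The possible parity unit leaves two consecutive values for
      \<open>2 * T\<close>, only one of them even; this becomes the floor.\<close>
    then have "2 * T + (n - 1 + r + (r + 2 + m)) \<le> (n - 2) * p"
      "(n - 2) * p \<le> 2 * T + (n - 1 + r + (r + 2 + m)) + 1"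
      using T E total by linarith+
    then have "real (2 * T + (n - 1 + r + (r + 2 + m))) \<le> real ((n - 2) * p)"
      "real ((n - 2) * p) \<le> real (2 * T + (n - 1 + r + (r + 2 + m)) + 1)"
      by (simp_all only: of_nat_le_iff)
    then have "2 * real T \<le> (real n - 2) * (real p - 1) - 2 * real r - real m - 3"
      "(real n - 2) * (real p - 1) - 2 * real r - real m - 3 < 2 * real T + 2"
      unfolding of_nat_add of_nat_mult real_pred real_pred2 by (simp_all add: algebra_simps)
    then have "\<lfloor>((real n - 2) * (real p - 1) - 2 * real r - real m - 3) / 2\<rfloor> = int T"
      by (intro floor_unique) auto
    then show ?thesis using True by (simp add: T_def)
  next
    case False
    have "\<exists>E L. tame m {..<r + 2 + m} E \<and> 2 * card E + L = m * (r + 2 + m) \<and> L = m * (r + 2 - m)"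
      using tame_bipartite[of m "r + 2"] mr by auto
    from extremal_graph[OF n4 this q, of j] obtain V :: "nat set" and E
      where V: "finite V" "E \<subseteq> [V]\<^bsup>2\<^esup>" "card V = p" "\<not> contains_subgraph (V, E) (T_star n)"
        and E: "2 * card E + m * (r + 2 - m) = (n - 3) * (n - 3 + (r + 2)) + j * ((n - 1) * (n - 2))"
      unfolding pj by blast
    note T = turan_numberI[OF bound V, folded T_def]
    have "a = n - 1 + r + m * (r + 2 - m)" unfolding a_def min_loss[OF r(1) mr] if_not_P[OF False] ..
    then have "2 * T + (n - 1 + r + m * (r + 2 - m)) = (n - 2) * p"
      using T E total by linarith
    then have "real (2 * T + (n - 1 + r + m * (r + 2 - m))) = real ((n - 2) * p)"
      by (simp only:)
    moreover have real_diff: "real (r + 2 - m) = real r + 2 - real m" using mr by (simp add: of_nat_diff)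
    ultimately have "2 * real T + (real n - 1 + real r + real m * (real r + 2 - real m)) = (real n - 2) * real p"
      unfolding of_nat_add of_nat_mult real_pred real_pred2 real_diff by simp
    then have "real T = ((real n - 2) * (real p - 1) - real m * (real r + 2 - real m) - real r - 1) / 2"
      by (simp add: algebra_simps)
    then show ?thesis unfolding T_def if_not_P[OF False] .
  qed
qed

end
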